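(* Let $B$ be a based space and $n\ge 1$ (any $n\ge0$). Then there is a homotopy $(\mathbf{Mon},\dots,\mathbf{Mon})$-algebra ($n$ copies) $(X,\xi)$ in $(\mathbf{Top},\times,1)$ with $X(1,\dots,1)=\mathbf{Top}_*(S^n,B)$; that is, every $n$-fold loop space is an $n$-fold homotopy monoid.
   Context: $\mathbf{Top}$: compactly generated Hausdorff spaces, cartesian product $\times$, point $1$, homotopy equivalences as equivalences. $\mathbf{Top}_*(S^n,B)$ is the space of based maps from the $n$-sphere to $B$. $\Delta$: objects $k=\{0,\dots,k-1\}$ ($k\ge0$), order-preserving maps, monoidal under ordinal sum $+$ with unit $0$. A homotopy $(\mathbf{Mon},\dots,\mathbf{Mon})$-algebra in $\mathbf{Top}$ is a colax multi-monoidal functor $(X,\xi):\Delta^n\to(\mathbf{Top},\times,1)$ in which all components of $\xi$ are homotopy equivalences. Here a colax multi-monoidal functor consists of a functor $X:\Delta^n\to\mathbf{Top}$ together with, for each $i\in\{1,\dots,n\}$ and all values of the other variables, maps $X(\dots,0,\dots)\to 1$ and $X(\dots,L_i+L_i',\dots)\to X(\dots,L_i,\dots)\times X(\dots,L_i',\dots)$ (in the $i$th variable), natural in all variables, such that for fixed values of the other variables these make $X$ a colax monoidal functor in the $i$th variable (coassociativity and counit axioms, maps not necessarily invertible), and such that for $i<j$ the structure maps in variables $i$ and $j$ commute: splitting $X(L_i+L_i',L_j+L_j')$ first in variable $i$ then $j$ agrees, after the canonical middle-four interchange, with splitting first in $j$ then $i$; splitting in $i$ then applying the counit in $j$ agrees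 with the counit in $j$ followed by $1\cong1\times1$ (and symmetrically); and the two counit maps $X(0,0)\to1$ (in variables $i$ and $j$) agree (other variables suppressed). *)

theory Defs
  imports "HOL-Analysis.Analysis"
begin

text \<open>k-ification of a topology: a set is open iff its trace on every compact subset is
  relatively open (for Hausdorff spaces this is the usual compactly generated refinement).\<close>
definition kify :: "'a topology \<Rightarrow> 'a topology" where
  "kify T = topology (\<lambda>U. U \<subseteq> topspace T \<and>
      (\<forall>K. compactin T K \<longrightarrow> openin (subtopology T K) (U \<inter> K)))"

definition cgh_space :: "'a topology \<Rightarrow> bool" where
  "cgh_space T \<longleftrightarrow> Hausdorff_space T \<and> kify T = T"

definition kprod :: "'a topology \<Rightarrow> 'b topology \<Rightarrow> ('a \<times> 'b) topology" where
  "kprod X Y = kify (prod_topology X Y)"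

definition point_space :: "unit topology" where
  "point_space = discrete_topology {()}"

definition homotopy_equivalence_map :: "'a topology \<Rightarrow> 'b topology \<Rightarrow> ('a \<Rightarrow> 'b) \<Rightarrow> bool" where
  "homotopy_equivalence_map X Y f \<longleftrightarrow> continuous_map X Y f \<and>
     (\<exists>g. continuous_map Y X g \<and>
          homotopic_with (\<lambda>x. True) X X (g \<circ> f) id \<and>
          homotopic_with (\<lambda>x. True) Y Y (f \<circ> g) id)"

definition sphere_base :: "nat \<Rightarrow> real" where
  "sphere_base = (\<lambda>i. if i = 0 then 1 else 0)"

definition compact_open :: "'a topology \<Rightarrow> 'b topology \<Rightarrow> ('a \<Rightarrow> 'b) set \<Rightarrow> ('a \<Rightarrow> 'b) topology" where
  "compact_open S B C = topology_generated_by
      {{f \<in> C. f ` K \<subseteq> U} | K U. compactin S K \<and> openin B U}"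

definition based_maps_set :: "nat \<Rightarrow> 'b topology \<Rightarrow> 'b \<Rightarrow> ((nat \<Rightarrow> real) \<Rightarrow> 'b) set" where
  "based_maps_set n B b0 = {f. continuous_map (nsphere n) B f \<and> f sphere_base = b0 \<and>
                               f \<in> extensional (topspace (nsphere n))}"

definition loop_space :: "nat \<Rightarrow> 'b topology \<Rightarrow> 'b \<Rightarrow> ((nat \<Rightarrow> real) \<Rightarrow> 'b) topology" where
  "loop_space n B b0 = kify (compact_open (nsphere n) B (based_maps_set n B b0))"

definition delta_hom :: "nat \<Rightarrow> nat \<Rightarrow> (nat \<Rightarrow> nat) \<Rightarrow> bool" where
  "delta_hom k m \<phi> \<longleftrightarrow> \<phi> \<in> {..<k} \<rightarrow>\<^sub>E {..<m} \<and> mono_on {..<k} \<phi>"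

definition delta_id :: "nat \<Rightarrow> nat \<Rightarrow> nat" where
  "delta_id k = restrict id {..<k}"

definition delta_comp :: "nat \<Rightarrow> (nat \<Rightarrow> nat) \<Rightarrow> (nat \<Rightarrow> nat) \<Rightarrow> nat \<Rightarrow> nat" where
  "delta_comp k \<psi> \<phi> = compose {..<k} \<psi> \<phi>"

definition delta_sum :: "nat \<Rightarrow> nat \<Rightarrow> nat \<Rightarrow> (nat \<Rightarrow> nat) \<Rightarrow> (nat \<Rightarrow> nat) \<Rightarrow> nat \<Rightarrow> nat" where
  "delta_sum a b c \<phi> \<psi> = restrict (\<lambda>x. if x < a then \<phi> x else c + \<psi> (x - a)) {..<a + b}"

definition deltan_obj :: "nat \<Rightarrow> nat list \<Rightarrow> bool" where
  "deltan_obj n L \<longleftrightarrow> length L = n"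

definition deltan_hom :: "nat \<Rightarrow> nat list \<Rightarrow> nat list \<Rightarrow> (nat \<Rightarrow> nat) list \<Rightarrow> bool" where
  "deltan_hom n L M fs \<longleftrightarrow> length L = n \<and> length M = n \<and> length fs = n \<and>
     (\<forall>i<n. delta_hom (L ! i) (M ! i) (fs ! i))"

definition deltan_id :: "nat list \<Rightarrow> (nat \<Rightarrow> nat) list" where
  "deltan_id L = map delta_id L"

definition deltan_comp :: "nat list \<Rightarrow> (nat \<Rightarrow> nat) list \<Rightarrow> (nat \<Rightarrow> nat) list \<Rightarrow> (nat \<Rightarrow> nat) list" where
  "deltan_comp L gs fs = map (\<lambda>i. delta_comp (L ! i) (gs ! i) (fs ! i)) [0..<length L]"

definition top_functor :: "nat \<Rightarrow> (nat list \<Rightarrow> 'x topology) \<Rightarrow>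
     (nat list \<Rightarrow> nat list \<Rightarrow> (nat \<Rightarrow> nat) list \<Rightarrow> 'x \<Rightarrow> 'x) \<Rightarrow> bool" where
  "top_functor n X Xf \<longleftrightarrow>
     (\<forall>L. deltan_obj n L \<longrightarrow> cgh_space (X L)) \<and>
     (\<forall>L M fs. deltan_hom n L M fs \<longrightarrow> continuous_map (X L) (X M) (Xf L M fs)) \<and>
     (\<forall>L. deltan_obj n L \<longrightarrow> (\<forall>x\<in>topspace (X L). Xf L L (deltan_id L) x = x)) \<and>
     (\<forall>L M P fs gs. deltan_hom n L M fs \<longrightarrow> deltan_hom n M P gs \<longrightarrow>
        (\<forall>x\<in>topspace (X L). Xf L P (deltan_comp L gs fs) x = Xf M P gs (Xf L M fs x)))"

text \<open>xi i L a b : X(L[i:=a+b]) \<rightarrow> X(L[i:=a]) \<times> X(L[i:=b]) is the comultiplication in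
  variable i (the i-th entry of L is irrelevant).  The counit X(L[i:=0]) \<rightarrow> 1 is the unique
  map to the point, so its naturality, and all compatibilities of counits with each other and
  with comultiplications, hold automatically; they are therefore not listed.\<close>
definition homotopy_mon_algebra :: "nat \<Rightarrow> (nat list \<Rightarrow> 'x topology) \<Rightarrow>
     (nat list \<Rightarrow> nat list \<Rightarrow> (nat \<Rightarrow> nat) list \<Rightarrow> 'x \<Rightarrow> 'x) \<Rightarrow>
     (nat \<Rightarrow> nat list \<Rightarrow> nat \<Rightarrow> nat \<Rightarrow> 'x \<Rightarrow> 'x \<times> 'x) \<Rightarrow> bool" where
  "homotopy_mon_algebra n X Xf xi \<longleftrightarrow>
     top_functor n X Xf \<and>
     \<comment> \<open>comultiplication maps are morphisms of Top and homotopy equivalences\<close>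
     (\<forall>i L a b. i < n \<longrightarrow> deltan_obj n L \<longrightarrow>
        continuous_map (X (L[i := a + b])) (kprod (X (L[i := a])) (X (L[i := b]))) (xi i L a b) \<and>
        homotopy_equivalence_map (X (L[i := a + b])) (kprod (X (L[i := a])) (X (L[i := b]))) (xi i L a b)) \<and>
     \<comment> \<open>counit maps X(...,0,...) \<rightarrow> 1 are homotopy equivalences\<close>
     (\<forall>i L. i < n \<longrightarrow> deltan_obj n L \<longrightarrow>
        homotopy_equivalence_map (X (L[i := 0])) point_space (\<lambda>_. ())) \<and>
     \<comment> \<open>naturality of comultiplication in all variables\<close>
     (\<forall>i L M fs a b c d \<phi> \<psi>. i < n \<longrightarrow> deltan_hom n L M fs \<longrightarrow>
        delta_hom a c \<phi> \<longrightarrow> delta_hom b d \<psi> \<longrightarrow>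
        (\<forall>x\<in>topspace (X (L[i := a + b])).
           xi i M c d (Xf (L[i := a + b]) (M[i := c + d]) (fs[i := delta_sum a b c \<phi> \<psi>]) x) =
           map_prod (Xf (L[i := a]) (M[i := c]) (fs[i := \<phi>]))
                    (Xf (L[i := b]) (M[i := d]) (fs[i := \<psi>])) (xi i L a b x))) \<and>
     \<comment> \<open>coassociativity\<close>
     (\<forall>i L a b c. i < n \<longrightarrow> deltan_obj n L \<longrightarrow>
        (\<forall>x\<in>topspace (X (L[i := a + b + c])).
           map_prod id (xi i L b c) (xi i L a (b + c) x) =
           (\<lambda>((u, v), w). (u, (v, w))) (map_prod (xi i L a b) id (xi i L (a + b) c x)))) \<and>
     \<comment> \<open>counit axioms (X(a) \<times> 1 \<cong> X(a) and 1 \<times> X(b) \<cong> X(b) are the projections)\<close>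
     (\<forall>i L a. i < n \<longrightarrow> deltan_obj n L \<longrightarrow>
        (\<forall>x\<in>topspace (X (L[i := a])). fst (xi i L a 0 x) = x \<and> snd (xi i L 0 a x) = x)) \<and>
     \<comment> \<open>interchange of comultiplications in variables i < j (middle-four interchange)\<close>
     (\<forall>i j L a a' b b'. i < j \<longrightarrow> j < n \<longrightarrow> deltan_obj n L \<longrightarrow>
        (\<forall>x\<in>topspace (X (L[i := a + a', j := b + b'])).
           map_prod (xi j (L[i := a]) b b') (xi j (L[i := a']) b b') (xi i (L[j := b + b']) a a' x) =
           (\<lambda>((z1, z2), (z3, z4)). ((z1, z3), (z2, z4)))
             (map_prod (xi i (L[j := b]) a a') (xi i (L[j := b']) a a') (xi j (L[i := a + a']) b b' x))))"

end

theory Submission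
  imports Defs
begin

text \<open>A composable string of \<open>k\<close> loops is, up to homotopy, a map to \<open>B\<close> from the cube
  \<open>[0,1]\<^sup>k\<close> with its monotone vertices \<open>(0,\<dots>,0,1,\<dots>,1)\<close> sent to the base point; a monotone map
  \<open>\<phi>: k \<rightarrow> m\<close> acts by precomposition \<open>y \<mapsto> y \<circ> \<phi>\<close>. In \<open>n\<close> variables, \<open>X(L)\<close> is the space of maps from
  \<open>[0,1]\<^bsup>L\<^esup>\<close> to \<open>B\<close> that send every point having a vertex as one of its \<open>n\<close> blocks to the base point.
  Splitting restricts a map to the faces \<open>(y,1,\<dots>,1)\<close> and \<open>(0,\<dots>,0,y)\<close> of one block, so all axioms are strict
  identities between maps of cubes. It is an equivalence because the union of the two faces, which meet only in a
  vertex, is a deformation retract of the cube relative to the vertices.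
  Finally \<open>X(1,\<dots>,1)\<close> consists of the maps on \<open>[0,1]\<^sup>n\<close> constant on the boundary, and collapsing the
  boundary gives the sphere.\<close>

section \<open>Spaces of based maps\<close>

text \<open>Two general facts deal with k-ification. A map from a k-space into a k-ified space is
  continuous as soon as it is so for the original topology, and the product of \<open>[0,1]\<close>
  with a k-space is again a k-space, because the interval is locally compact Hausdorff. So
  precomposition, pasting and homotopies are all checked against compact-open topologies, where the
  tube lemma applies. On the side of the cubes the obstacle is that the base conditions sit in all
  blocks at once: the retraction onto the two faces may move only block \<open>i\<close>, and it
  must keep the vertices of that block still. It has an explicit formula: let \<open>s\<close> be
  the l1 distance of the front half of the block from the zeros and \<open>d\<close> that of the
  back half from the ones; lower the front by \<open>d\<close>, raise the back by \<open>s\<close>,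
  and truncate to \<open>[0,1]\<close>. Which of \<open>s\<close> and \<open>d\<close> is larger
  decides the face on which the point lands. Cutting a pasted map returns its two pieces exactly, so
  only one of the two composites needs a genuine homotopy.\<close>

lemma kify_eq_kification: "kify T = kification T"
  by (simp add: kify_def kification_def kification_open_def Int_commute)

lemma Hausdorff_space_kification: "Hausdorff_space X \<Longrightarrow> Hausdorff_space (kification X)"
  unfolding Hausdorff_space_def by (metis openin_kification_finer topspace_kification)

lemma topspace_kprod [simp]: "topspace (kprod X Y) = topspace X \<times> topspace Y"
  by (simp add: kprod_def kify_eq_kification)

lemma k_space_kprod: "k_space (kprod X Y)"
  by (simp add: kprod_def kify_eq_kification)

lemma continuous_map_kprodI:
  assumes "k_space X" "continuous_map X Y f" "continuous_map X Z g"
  shows "continuous_map X (kprod Y Z) (\<lambda>x. (f x, g x))"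
  unfolding kprod_def kify_eq_kification using assms
  by (simp add: continuous_map_into_kification continuous_map_pairedI)

locale based_space =
  fixes B :: "'b topology" and b0 :: 'b
  assumes Hausdorff_B: "Hausdorff_space B" and b0_in: "b0 \<in> topspace B"
begin

text \<open>The prescribed carrier type of the algebra is a product whose first factor is superfluous,
  so all points carry the same first component.\<close>
definition based_maps :: "'a::t2_space set \<Rightarrow> 'a set \<Rightarrow> ('a \<times> ('a \<Rightarrow> 'b)) set" where
  "based_maps K Z = {p. fst p = undefined \<and> continuous_map (top_of_set K) B (snd p) \<and>
     (\<forall>z\<in>Z. snd p z = b0) \<and> snd p \<in> extensional K}"

definition co_space :: "'a::t2_space set \<Rightarrow> 'a set \<Rightarrow> ('a \<times> ('a \<Rightarrow> 'b)) topology" where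
  "co_space K Z = topology_generated_by
     {{p \<in> based_maps K Z. snd p ` C \<subseteq> U} | C U. compactin (top_of_set K) C \<and> openin B U}"

definition map_space :: "'a::t2_space set \<Rightarrow> 'a set \<Rightarrow> ('a \<times> ('a \<Rightarrow> 'b)) topology" where
  "map_space K Z = kification (co_space K Z)"

definition pull :: "'a set \<Rightarrow> ('a \<Rightarrow> 'a) \<Rightarrow> 'a \<times> ('a \<Rightarrow> 'b) \<Rightarrow> 'a \<times> ('a \<Rightarrow> 'b)" where
  "pull K g p = (undefined, restrict (snd p \<circ> g) K)"

lemma topspace_co_space [simp]: "topspace (co_space K Z) = based_maps K Z"
proof -
  \<comment> \<open>The empty compact set makes the whole carrier a subbasic set, so the union of
    the subbasis is everything.\<close>
  have "based_maps K Z = {p \<in> based_maps K Z. snd p ` {} \<subseteq> topspace B}" by simp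
  then have "based_maps K Z \<in> {{p \<in> based_maps K Z. snd p ` C \<subseteq> U} | C U. compactin (top_of_set K) C \<and> openin B U}"
    by (intro CollectI exI[of _ "{}"] exI[of _ "topspace B"]) auto
  then show ?thesis
    by (auto simp: co_space_def topology_generated_by_topspace)
qed

lemma topspace_map_space [simp]: "topspace (map_space K Z) = based_maps K Z"
  by (simp add: map_space_def)

lemma k_space_map_space [simp]: "k_space (map_space K Z)"
  by (simp add: map_space_def)

lemma openin_co_space:
  assumes "compactin (top_of_set K) C" "openin B U"
  shows "openin (co_space K Z) {p \<in> based_maps K Z. snd p ` C \<subseteq> U}"
  unfolding co_space_def by (rule topology_generated_by_Basis) (use assms in auto)

lemma continuous_map_into_co_space:
  assumes "\<And>x. x \<in> topspace T \<Longrightarrow> F x \<in> based_maps K Z"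
    and "\<And>C U. \<lbrakk>compactin (top_of_set K) C; openin B U\<rbrakk> \<Longrightarrow> openin T {x \<in> topspace T. snd (F x) ` C \<subseteq> U}"
  shows "continuous_map T (co_space K Z) F"
  unfolding co_space_def
proof (rule continuous_on_generated_topo)
  fix V assume "V \<in> {{p \<in> based_maps K Z. snd p ` C \<subseteq> U} | C U. compactin (top_of_set K) C \<and> openin B U}"
  then obtain C U where V: "V = {p \<in> based_maps K Z. snd p ` C \<subseteq> U}"
    and CU: "compactin (top_of_set K) C" "openin B U" by auto
  have "F -` V \<inter> topspace T = {x \<in> topspace T. snd (F x) ` C \<subseteq> U}"
    using assms(1) V by auto
  then show "openin T (F -` V \<inter> topspace T)"
    using assms(2)[OF CU] by simp
next
  show "F ` topspace T \<subseteq> \<Union> {{p \<in> based_maps K Z. snd p ` C \<subseteq> U} | C U. compactin (top_of_set K) C \<and> openin B U}"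
    using assms(1) topspace_co_space[of K Z] unfolding co_space_def topology_generated_by_topspace by auto
qed

lemma continuous_map_into_map_space:
  "k_space T \<Longrightarrow> continuous_map T (map_space K Z) F \<longleftrightarrow> continuous_map T (co_space K Z) F"
  by (simp add: map_space_def continuous_map_into_kification)

lemma based_maps_eqI:
  assumes "p \<in> based_maps K Z" "q \<in> based_maps K Z" "\<And>x. x \<in> K \<Longrightarrow> snd p x = snd q x"
  shows "p = q"
  using assms by (auto simp: based_maps_def prod_eq_iff intro: extensionalityI)

text \<open>Singletons are compact, so disjoint open sets around two different values in
  \<open>B\<close> give disjoint subbasic sets around the two maps.\<close>

lemma Hausdorff_co_space: "Hausdorff_space (co_space K Z)"
  unfolding Hausdorff_space_def topspace_co_space
proof (intro allI impI, elim conjE)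
  fix p q assume p: "p \<in> based_maps K Z" and q: "q \<in> based_maps K Z" and "p \<noteq> q"
  then obtain x where x: "x \<in> K" "snd p x \<noteq> snd q x" using based_maps_eqI by metis
  have "snd p x \<in> topspace B" "snd q x \<in> topspace B"
    using p q x unfolding based_maps_def continuous_map_def by auto
  then obtain U V where UV: "openin B U" "openin B V" "snd p x \<in> U" "snd q x \<in> V" "disjnt U V"
    using Hausdorff_B x unfolding Hausdorff_space_def by metis
  have C: "compactin (top_of_set K) {x}" using x by auto
  show "\<exists>U V. openin (co_space K Z) U \<and> openin (co_space K Z) V \<and> p \<in> U \<and> q \<in> V \<and> disjnt U V"
    by (rule exI[of _ "{p \<in> based_maps K Z. snd p ` {x} \<subseteq> U}"],
        rule exI[of _ "{p \<in> based_maps K Z. snd p ` {x} \<subseteq> V}"])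
      (use openin_co_space[OF C] UV p q in \<open>auto simp: disjnt_def\<close>)
qed

lemma cgh_map_space: "cgh_space (map_space K Z)"
  by (simp add: cgh_space_def map_space_def kify_eq_kification Hausdorff_space_kification Hausdorff_co_space)

lemma snd_pull: "x \<in> K \<Longrightarrow> snd (pull K g p) x = snd p (g x)"
  by (simp add: pull_def)

lemma pull_in_based_maps:
  assumes p: "p \<in> based_maps K' Z'" and g: "continuous_on K g" "g ` K \<subseteq> K'" "g ` Z \<subseteq> Z'" and "Z \<subseteq> K"
  shows "pull K g p \<in> based_maps K Z"
proof -
  have "continuous_map (top_of_set K) (top_of_set K') g"
    using g by auto
  then have "continuous_map (top_of_set K) B (snd p \<circ> g)"
    using p continuous_map_compose unfolding based_maps_def by blast
  then have "continuous_map (top_of_set K) B (restrict (snd p \<circ> g) K)"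
    by (rule continuous_map_eq) auto
  then show ?thesis using p g \<open>Z \<subseteq> K\<close> by (auto simp: based_maps_def pull_def)
qed

lemma pull_cong: "(\<And>x. x \<in> K \<Longrightarrow> g x = h x) \<Longrightarrow> pull K g p = pull K h p"
  by (auto simp: pull_def)

lemma pull_pull: "g ` K \<subseteq> K' \<Longrightarrow> pull K g (pull K' h p) = pull K (h \<circ> g) p"
  by (auto simp: pull_def restrict_def fun_eq_iff image_subset_iff)

lemma pull_id: "\<lbrakk>p \<in> based_maps K Z; \<And>x. x \<in> K \<Longrightarrow> g x = x\<rbrakk> \<Longrightarrow> pull K g p = p"
  by (auto simp: pull_def based_maps_def prod_eq_iff extensional_def restrict_def)

text \<open>Near \<open>(t, p)\<close> the time can be confined to a compact neighbourhood
  \<open>J\<close>. Then \<open>H\<close> sends \<open>J x C\<close> onto one compact set, and the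
  single subbasic condition that this set goes into \<open>U\<close> controls all times in
  \<open>J\<close> at once.\<close>

lemma continuous_map_pull_homotopy_co:
  assumes H: "continuous_on ({0..1::real} \<times> K) (\<lambda>(t, x). H t x)"
    and HK: "\<And>t x. \<lbrakk>t \<in> {0..1}; x \<in> K\<rbrakk> \<Longrightarrow> H t x \<in> K'"
    and HZ: "\<And>t x. \<lbrakk>t \<in> {0..1}; x \<in> Z\<rbrakk> \<Longrightarrow> H t x \<in> Z'" and ZK: "Z \<subseteq> K"
  shows "continuous_map (prod_topology (top_of_set {0..1::real}) (co_space K' Z')) (co_space K Z)
           (\<lambda>(t, p). pull K (H t) p)" (is "continuous_map ?P _ ?F")
proof (rule continuous_map_into_co_space)
  have cont: "continuous_on K (H t)" if "t \<in> {0..1}" for t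
  proof -
    have "continuous_on K ((\<lambda>(t, x). H t x) \<circ> Pair t)"
      by (rule continuous_on_o_Pair[OF H that])
    then show ?thesis by (simp add: o_def)
  qed
  show "?F x \<in> based_maps K Z" if "x \<in> topspace ?P" for x
    using that cont HK HZ ZK by (auto intro!: pull_in_based_maps)
  fix C U assume C: "compactin (top_of_set K) C" and U: "openin B U"
  have CK: "C \<subseteq> K" "compact C" using C by (auto simp: compactin_subtopology)
  let ?S = "{x \<in> topspace ?P. snd (?F x) ` C \<subseteq> U}"
  show "openin ?P ?S"
  proof (subst openin_subopen, rule ballI)
    fix z assume "z \<in> ?S"
    moreover obtain t p where z: "z = (t, p)" by (rule prod.exhaust)
    ultimately have tp: "(t, p) \<in> topspace ?P" and sub: "snd (pull K (H t) p) ` C \<subseteq> U"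
      by simp_all
    have t: "t \<in> {0..1}" and p: "p \<in> based_maps K' Z'" using tp by auto
    have Hmap: "continuous_map (prod_topology (top_of_set {0..1}) (top_of_set K)) (top_of_set K') (\<lambda>(t, x). H t x)"
      unfolding prod_topology_subtopology_eu
      using H HK by auto
    have "continuous_map (prod_topology (top_of_set {0..1}) (top_of_set K)) B (snd p \<circ> (\<lambda>(t, x). H t x))"
      by (rule continuous_map_compose[OF Hmap]) (use p in \<open>auto simp: based_maps_def\<close>)
    from openin_continuous_map_preimage[OF this U]
    have op: "openin (prod_topology (top_of_set {0..1}) (top_of_set K))
      {x \<in> topspace (prod_topology (top_of_set {0..1}) (top_of_set K)). (snd p \<circ> (\<lambda>(t, x). H t x)) x \<in> U}" .
    have "\<exists>V W. openin (top_of_set {0..1}) V \<and> openin (top_of_set K) W \<and> t \<in> V \<and> C \<subseteq> W \<and>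
        V \<times> W \<subseteq> {x \<in> topspace (prod_topology (top_of_set {0..1}) (top_of_set K)). (snd p \<circ> (\<lambda>(t, x). H t x)) x \<in> U}"
      by (rule tube_lemma_right[OF op C]) (use t sub CK in \<open>auto simp: snd_pull image_subset_iff subset_iff\<close>)
    then obtain V W where V: "openin (top_of_set {0..1}) V" "t \<in> V" "C \<subseteq> W"
      and sub: "V \<times> W \<subseteq> {x \<in> topspace (prod_topology (top_of_set {0..1}) (top_of_set K)). (snd p \<circ> (\<lambda>(t, x). H t x)) x \<in> U}"
      by (elim exE conjE)
    have VW: "snd p (H s x) \<in> U" if "s \<in> V" "x \<in> W" for s x
      using subsetD[OF sub, of "(s, x)"] that by simp
    \<comment> \<open>The tube lemma gives only an open \<open>V\<close>; a compact neighbourhood of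
      \<open>t\<close> inside it is needed for the image \<open>D\<close> to be compact.\<close>
    have "neighbourhood_base_of (compactin (top_of_set {0..1::real})) (top_of_set {0..1})"
      by (intro locally_compact_imp_neighbourhood_base compact_imp_locally_compact_space
          compact_Hausdorff_imp_regular_space) (auto simp: compact_space_subtopology Hausdorff_space_subtopology)
    then obtain V' J where J: "openin (top_of_set {0..1}) V'" "compactin (top_of_set {0..1}) J"
       "t \<in> V'" "V' \<subseteq> J" "J \<subseteq> V"
      using V unfolding neighbourhood_base_of by meson
    have J01: "J \<subseteq> {0..1}" "compact J" using J by (auto simp: compactin_subtopology)
    define D where "D = (\<lambda>(t, x). H t x) ` (J \<times> C)"
    have "compact D"
      unfolding D_def
      by (intro compact_continuous_image continuous_on_subset[OF H] compact_Times) (use J01 CK in auto)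
    moreover have "H s x \<in> K'" if "s \<in> J" "x \<in> C" for s x
      using HK[of s x] that J01 CK by blast
    then have "D \<subseteq> K'" unfolding D_def by auto
    ultimately have D: "compactin (top_of_set K') D" by (simp add: compactin_subtopology)
    let ?T = "V' \<times> {p \<in> based_maps K' Z'. snd p ` D \<subseteq> U}"
    have "openin ?P ?T"
      using J(1) openin_co_space[OF D U] by (simp add: openin_prod_Times_iff)
    moreover have "(t, p) \<in> ?T"
    proof -
      have "snd p (H s x) \<in> U" if "s \<in> J" "x \<in> C" for s x
        using VW[of s x] that J V by blast
      then show ?thesis using J p unfolding D_def by auto
    qed
    moreover have "?T \<subseteq> ?S"
    proof
      fix y assume "y \<in> ?T"
      then obtain s q where y: "y = (s, q)" and s: "s \<in> V'" and "q \<in> {p \<in> based_maps K' Z'. snd p ` D \<subseteq> U}"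
        by (rule SigmaE)
      then have q: "q \<in> based_maps K' Z'" and qD: "snd q ` D \<subseteq> U" by simp_all
      have "s \<in> J" using s J by auto
      then have "s \<in> {0..1}" and "snd (pull K (H s) q) ` C \<subseteq> U"
        using J01 qD CK by (auto simp: D_def snd_pull image_subset_iff)
      then show "y \<in> ?S" using q y by simp
    qed
    ultimately show "\<exists>T. openin ?P T \<and> z \<in> T \<and> T \<subseteq> ?S" using z by blast
  qed
qed

text \<open>The source is a plain product, as \<open>homotopic_with\<close> demands, and not a
  \<open>kprod\<close>. It is a k-space all the same, since one factor is the compact Hausdorff
  interval, so the target may be given its compact-open topology.\<close>

lemma continuous_map_pull_homotopy:
  assumes "continuous_on ({0..1::real} \<times> K) (\<lambda>(t, x). H t x)"
    and "\<And>t x. \<lbrakk>t \<in> {0..1}; x \<in> K\<rbrakk> \<Longrightarrow> H t x \<in> K'"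
    and "\<And>t x. \<lbrakk>t \<in> {0..1}; x \<in> Z\<rbrakk> \<Longrightarrow> H t x \<in> Z'" and "Z \<subseteq> K"
  shows "continuous_map (prod_topology (top_of_set {0..1::real}) (map_space K' Z')) (map_space K Z)
           (\<lambda>(t, p). pull K (H t) p)"
proof -
  have ks: "k_space (prod_topology (top_of_set {0..1::real}) (map_space K' Z'))"
    by (intro k_space_prod_topology_left compact_imp_locally_compact_space disjI1)
      (auto simp: compact_space_subtopology Hausdorff_space_subtopology)
  have "continuous_map (prod_topology (top_of_set {0..1::real}) (map_space K' Z'))
      (prod_topology (top_of_set {0..1::real}) (co_space K' Z')) id"
  proof -
    have "continuous_map (map_space K' Z') (co_space K' Z') id"
      unfolding map_space_def by (rule continuous_map_from_kification) simp
    then have "continuous_map (prod_topology (top_of_set {0..1::real}) (map_space K' Z'))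
      (prod_topology (top_of_set {0..1::real}) (co_space K' Z')) (\<lambda>x. (fst x, id (snd x)))"
      by (intro continuous_map_pairedI continuous_map_fst continuous_map_compose[OF continuous_map_snd, unfolded o_def])
    then show ?thesis by (simp add: id_def)
  qed
  then have "continuous_map (prod_topology (top_of_set {0..1::real}) (map_space K' Z')) (co_space K Z)
      ((\<lambda>(t, p). pull K (H t) p) \<circ> id)"
    by (rule continuous_map_compose) (rule continuous_map_pull_homotopy_co[OF assms])
  with ks show ?thesis by (simp add: continuous_map_into_map_space)
qed

text \<open>This is the constant homotopy evaluated at time 0.\<close>

lemma continuous_map_pull:
  assumes "continuous_on K g" "g ` K \<subseteq> K'" "g ` Z \<subseteq> Z'" "Z \<subseteq> K"
  shows "continuous_map (map_space K' Z') (map_space K Z) (pull K g)"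
proof -
  have "continuous_on ({0..1::real} \<times> K) (\<lambda>(t, x). g x)"
    using continuous_on_compose2[OF assms(1) continuous_on_snd[OF continuous_on_id], of "{0..1::real} \<times> K"]
    by (auto simp: case_prod_unfold)
  then have "continuous_map (prod_topology (top_of_set {0..1::real}) (map_space K' Z')) (map_space K Z)
           (\<lambda>(t, p). pull K g p)"
    using assms by (intro continuous_map_pull_homotopy[of K "\<lambda>t. g"]) auto
  from continuous_map_o_Pair[OF this, of 0] show ?thesis by (simp add: o_def)
qed

section \<open>Pasting two based maps along a closed cover\<close>

definition glue :: "'a set \<Rightarrow> 'a set \<Rightarrow> ('a \<Rightarrow> 'a) \<Rightarrow> ('a \<Rightarrow> 'a) \<Rightarrow>
    ('a \<times> ('a \<Rightarrow> 'b)) \<times> ('a \<times> ('a \<Rightarrow> 'b)) \<Rightarrow> 'a \<times> ('a \<Rightarrow> 'b)" where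
  "glue K A r1 r2 = (\<lambda>(p, q). (undefined, restrict (\<lambda>x. if x \<in> A then snd p (r1 x) else snd q (r2 x)) K))"

lemma snd_glue:
  "x \<in> K \<Longrightarrow> snd (glue K A r1 r2 (p, q)) x = (if x \<in> A then snd p (r1 x) else snd q (r2 x))"
  by (simp add: glue_def)

end

text \<open>Abstracts a retraction of \<open>K\<close> onto two pieces modelled on \<open>K1\<close>
  and \<open>K2\<close>: \<open>A1\<close> and \<open>A2\<close> are the regions retracted onto
  either piece, and \<open>r1\<close>, \<open>r2\<close> give the place reached. On the overlap both
  land in base sets, so maps pasted from the two sides agree there with value \<open>b0\<close>. The
  embeddings of the pieces enter only in \<open>homotopy_equivalence_map_wedge\<close>.\<close>

locale wedge_data = based_space B b0 for B :: "'b topology" and b0 +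
  fixes K A1 A2 Z K1 Z1 K2 Z2 :: "'a::t2_space set" and r1 r2 :: "'a \<Rightarrow> 'a"
  assumes K: "compact K" and A: "closed A1" "closed A2" "K \<subseteq> A1 \<union> A2"
    and r1: "continuous_on K r1" "r1 ` K \<subseteq> K1" and r2: "continuous_on K r2" "r2 ` K \<subseteq> K2"
    and overlap: "\<And>x. \<lbrakk>x \<in> K; x \<in> A1; x \<in> A2\<rbrakk> \<Longrightarrow> r1 x \<in> Z1 \<and> r2 x \<in> Z2"
    and based1: "\<And>x. \<lbrakk>x \<in> Z; x \<in> A1\<rbrakk> \<Longrightarrow> r1 x \<in> Z1" and based2: "\<And>x. \<lbrakk>x \<in> Z; x \<in> A2\<rbrakk> \<Longrightarrow> r2 x \<in> Z2"
    and Z: "Z \<subseteq> K" "Z1 \<subseteq> K1" "Z2 \<subseteq> K2"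
begin

lemma snd_glue_right:
  assumes "p \<in> based_maps K1 Z1" "q \<in> based_maps K2 Z2" "x \<in> K" "x \<in> A2"
  shows "snd (glue K A1 r1 r2 (p, q)) x = snd q (r2 x)"
  using assms overlap by (auto simp: snd_glue based_maps_def)

text \<open>The pasting lemma for a cover by two closed sets, read off from preimages of closed
  sets.\<close>

lemma glue_in_based_maps:
  assumes p: "p \<in> based_maps K1 Z1" and q: "q \<in> based_maps K2 Z2"
  shows "glue K A1 r1 r2 (p, q) \<in> based_maps K Z"
proof -
  let ?g = "snd (glue K A1 r1 r2 (p, q))"
  have 1: "continuous_map (top_of_set K) B (snd p \<circ> r1)"
    by (rule continuous_map_compose[of _ "top_of_set K1"]) (use p r1 in \<open>auto simp: based_maps_def\<close>)
  have 2: "continuous_map (top_of_set K) B (snd q \<circ> r2)"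
    by (rule continuous_map_compose[of _ "top_of_set K2"]) (use q r2 in \<open>auto simp: based_maps_def\<close>)
  have "continuous_map (top_of_set K) B ?g"
    unfolding continuous_map_closedin
  proof (intro conjI allI impI)
    show "?g \<in> topspace (top_of_set K) \<rightarrow> topspace B"
      using 1 2 by (auto simp: snd_glue continuous_map_def Pi_iff)
    fix C assume C: "closedin B C"
    have "{x \<in> topspace (top_of_set K). ?g x \<in> C} =
        (A1 \<inter> {x \<in> topspace (top_of_set K). (snd p \<circ> r1) x \<in> C}) \<union>
        (A2 \<inter> {x \<in> topspace (top_of_set K). (snd q \<circ> r2) x \<in> C})"
      using A snd_glue_right[OF p q] by (auto simp: snd_glue split: if_splits)
    moreover have "closedin (top_of_set K) (A1 \<inter> {x \<in> topspace (top_of_set K). (snd p \<circ> r1) x \<in> C})"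
    proof -
      have "closedin (top_of_set K) ((K \<inter> A1) \<inter> {x \<in> topspace (top_of_set K). (snd p \<circ> r1) x \<in> C})"
        by (rule closedin_Int[OF closedin_closed_Int[OF A(1)] closedin_continuous_map_preimage[OF 1 C]])
      moreover have "(K \<inter> A1) \<inter> {x \<in> topspace (top_of_set K). (snd p \<circ> r1) x \<in> C} =
         A1 \<inter> {x \<in> topspace (top_of_set K). (snd p \<circ> r1) x \<in> C}" by auto
      ultimately show ?thesis by simp
    qed
    moreover have "closedin (top_of_set K) (A2 \<inter> {x \<in> topspace (top_of_set K). (snd q \<circ> r2) x \<in> C})"
    proof -
      have "closedin (top_of_set K) ((K \<inter> A2) \<inter> {x \<in> topspace (top_of_set K). (snd q \<circ> r2) x \<in> C})"
        by (rule closedin_Int[OF closedin_closed_Int[OF A(2)] closedin_continuous_map_preimage[OF 2 C]])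
      moreover have "(K \<inter> A2) \<inter> {x \<in> topspace (top_of_set K). (snd q \<circ> r2) x \<in> C} =
         A2 \<inter> {x \<in> topspace (top_of_set K). (snd q \<circ> r2) x \<in> C}" by auto
      ultimately show ?thesis by simp
    qed
    ultimately show "closedin (top_of_set K) {x \<in> topspace (top_of_set K). ?g x \<in> C}" 
      by (simp only: closedin_Un)
  qed
  moreover have "?g z = b0" if "z \<in> Z" for z
  proof -
    have "z \<in> K" using that Z by blast
    moreover have "z \<in> A2" if "z \<notin> A1" using that A calculation by blast
    ultimately show ?thesis
      using p q based1[OF that] based2[OF that] by (simp add: snd_glue based_maps_def)
  qed
  moreover have "fst (glue K A1 r1 r2 (p, q)) = undefined" "?g \<in> extensional K"
    by (auto simp: glue_def)
  ultimately show ?thesis by (simp add: based_maps_def)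
qed

text \<open>A compact \<open>C\<close> splits into \<open>C Int A1\<close> and
  \<open>C Int A2\<close>, both compact. The subbasic condition on the pasted map is therefore a
  product of two subbasic conditions, one on the image of each part.\<close>

lemma continuous_map_glue:
  "continuous_map (kprod (map_space K1 Z1) (map_space K2 Z2)) (map_space K Z) (glue K A1 r1 r2)"
proof -
  let ?P = "prod_topology (co_space K1 Z1) (co_space K2 Z2)"
  have "continuous_map ?P (co_space K Z) (glue K A1 r1 r2)"
  proof (rule continuous_map_into_co_space)
    show "glue K A1 r1 r2 x \<in> based_maps K Z" if "x \<in> topspace ?P" for x
      using that glue_in_based_maps by (cases x) auto
    fix C U assume C: "compactin (top_of_set K) C" and U: "openin B U"
    have CK: "C \<subseteq> K" "compact C" using C by (auto simp: compactin_subtopology)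
    have "compact (r1 ` (C \<inter> A1))" "compact (r2 ` (C \<inter> A2))"
      by (intro compact_continuous_image continuous_on_subset[OF r1(1)] continuous_on_subset[OF r2(1)]
          compact_Int_closed; use CK A in auto)+
    then have C12: "compactin (top_of_set K1) (r1 ` (C \<inter> A1))" "compactin (top_of_set K2) (r2 ` (C \<inter> A2))"
      using r1 r2 CK by (auto simp: compactin_subtopology image_subset_iff subset_iff)
    have "{x \<in> topspace ?P. snd (glue K A1 r1 r2 x) ` C \<subseteq> U} =
      {p \<in> based_maps K1 Z1. snd p ` (r1 ` (C \<inter> A1)) \<subseteq> U} \<times> {q \<in> based_maps K2 Z2. snd q ` (r2 ` (C \<inter> A2)) \<subseteq> U}"
      (is "?L = ?R")
    proof (intro set_eqI)
      fix x :: "('a \<times> ('a \<Rightarrow> 'b)) \<times> ('a \<times> ('a \<Rightarrow> 'b))"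
      obtain p q where x: "x = (p, q)" by (cases x)
      have "snd (glue K A1 r1 r2 (p, q)) ` C \<subseteq> U \<longleftrightarrow>
        snd p ` (r1 ` (C \<inter> A1)) \<subseteq> U \<and> snd q ` (r2 ` (C \<inter> A2)) \<subseteq> U"
        if p: "p \<in> based_maps K1 Z1" and q: "q \<in> based_maps K2 Z2"
      proof -
        have 1: "snd (glue K A1 r1 r2 (p, q)) x = snd p (r1 x)" if "x \<in> C" "x \<in> A1" for x
          using that CK by (auto simp: snd_glue)
        have 2: "snd (glue K A1 r1 r2 (p, q)) x = snd q (r2 x)" if "x \<in> C" "x \<in> A2" for x
          using that CK snd_glue_right[OF p q] by blast
        have "C = (C \<inter> A1) \<union> (C \<inter> A2)" using CK A by auto
        then have "snd (glue K A1 r1 r2 (p, q)) ` C = 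
          snd (glue K A1 r1 r2 (p, q)) ` (C \<inter> A1) \<union> snd (glue K A1 r1 r2 (p, q)) ` (C \<inter> A2)" by blast
        also have "\<dots> = snd p ` (r1 ` (C \<inter> A1)) \<union> snd q ` (r2 ` (C \<inter> A2))"
          using 1 2 by (auto simp: image_image)
        finally show ?thesis by simp
      qed
      then show "x \<in> ?L \<longleftrightarrow> x \<in> ?R"
        unfolding x by (simp only: mem_Collect_eq mem_Sigma_iff topspace_prod_topology topspace_co_space) blast
    qed
    then show "openin ?P {x \<in> topspace ?P. snd (glue K A1 r1 r2 x) ` C \<subseteq> U}"
      using openin_co_space[OF C12(1) U] openin_co_space[OF C12(2) U] by (simp add: openin_prod_Times_iff)
  qed
  \<comment> \<open>k-ification only refines topologies, so the identity is continuous onto the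
    product of the compact-open topologies.\<close>
  moreover have "continuous_map (kprod (map_space K1 Z1) (map_space K2 Z2)) ?P id"
  proof -
    have "continuous_map (map_space K1 Z1) (co_space K1 Z1) id" "continuous_map (map_space K2 Z2) (co_space K2 Z2) id"
      unfolding map_space_def by (auto intro!: continuous_map_from_kification)
    then have "continuous_map (prod_topology (map_space K1 Z1) (map_space K2 Z2)) ?P (\<lambda>x. (id (fst x), id (snd x)))"
      by (intro continuous_map_pairedI continuous_map_compose[OF continuous_map_snd, unfolded o_def]
          continuous_map_compose[OF continuous_map_fst, unfolded o_def])
    then show ?thesis 
      by (simp add: id_def kprod_def kify_eq_kification continuous_map_from_kification)
  qed
  ultimately have "continuous_map (kprod (map_space K1 Z1) (map_space K2 Z2)) (co_space K Z) (glue K A1 r1 r2 \<circ> id)"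
    by (rule continuous_map_compose[rotated])
  then show ?thesis by (simp add: continuous_map_into_map_space k_space_kprod)
qed

text \<open>The homotopy inverse is \<open>glue\<close>. Cutting after pasting is the identity
  because \<open>r1\<close> and \<open>r2\<close> undo the embeddings; pasting after cutting is
  precomposition with \<open>H 0\<close>, which \<open>H\<close> joins to the identity through maps
  that preserve \<open>Z\<close>.\<close>

lemma homotopy_equivalence_map_wedge:
  assumes i1: "continuous_on K1 i1" "i1 ` K1 \<subseteq> K \<inter> A1" "i1 ` Z1 \<subseteq> Z" "\<And>x. x \<in> K1 \<Longrightarrow> r1 (i1 x) = x"
    and i2: "continuous_on K2 i2" "i2 ` K2 \<subseteq> K \<inter> A2" "i2 ` Z2 \<subseteq> Z" "\<And>x. x \<in> K2 \<Longrightarrow> r2 (i2 x) = x"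
    and H: "continuous_on ({0..1::real} \<times> K) (\<lambda>(t, x). H t x)"
      "\<And>t x. \<lbrakk>t \<in> {0..1}; x \<in> K\<rbrakk> \<Longrightarrow> H t x \<in> K"
      "\<And>t x. \<lbrakk>t \<in> {0..1}; x \<in> Z\<rbrakk> \<Longrightarrow> H t x \<in> Z"
      "\<And>x. x \<in> K \<Longrightarrow> H 1 x = x"
      "\<And>x. \<lbrakk>x \<in> K; x \<in> A1\<rbrakk> \<Longrightarrow> H 0 x = i1 (r1 x)"
      "\<And>x. \<lbrakk>x \<in> K; x \<in> A2\<rbrakk> \<Longrightarrow> H 0 x = i2 (r2 x)"
  shows "homotopy_equivalence_map (map_space K Z) (kprod (map_space K1 Z1) (map_space K2 Z2))
           (\<lambda>p. (pull K1 i1 p, pull K2 i2 p))" (is "homotopy_equivalence_map ?X ?Y ?f")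
proof -
  let ?g = "glue K A1 r1 r2"
  have cf: "continuous_map ?X ?Y ?f"
    by (intro continuous_map_kprodI k_space_map_space continuous_map_pull) (use i1 i2 Z in auto)
  have cg: "continuous_map ?Y ?X ?g" by (rule continuous_map_glue)
  have fg: "?f (?g y) = y" if "y \<in> topspace ?Y" for y
  proof -
    obtain p q where y: "y = (p, q)" by (rule prod.exhaust)
    then have p: "p \<in> based_maps K1 Z1" and q: "q \<in> based_maps K2 Z2"
      using that by auto
    have g: "?g (p, q) \<in> based_maps K Z" using glue_in_based_maps p q .
    have "pull K1 i1 (?g (p, q)) = p"
    proof (rule based_maps_eqI[OF pull_in_based_maps[OF g] p])
      fix x assume x: "x \<in> K1"
      then have "i1 x \<in> K" "i1 x \<in> A1" using i1 by auto
      then show "snd (pull K1 i1 (?g (p, q))) x = snd p x"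
        using x i1(4) by (simp add: snd_pull snd_glue)
    qed (use i1 Z in auto)
    moreover have "pull K2 i2 (?g (p, q)) = q"
    proof (rule based_maps_eqI[OF pull_in_based_maps[OF g] q])
      fix x assume x: "x \<in> K2"
      then have "i2 x \<in> K" "i2 x \<in> A2" using i2 by auto
      then show "snd (pull K2 i2 (?g (p, q))) x = snd q x"
        using x i2(4) by (simp add: snd_pull snd_glue_right[OF p q])
    qed (use i2 Z in auto)
    ultimately show ?thesis by (simp add: y)
  qed
  have gf: "?g (?f p) = pull K (H 0) p" if p: "p \<in> based_maps K Z" for p
  proof -
    have p1: "pull K1 i1 p \<in> based_maps K1 Z1" by (rule pull_in_based_maps[OF p]) (use i1 Z in auto)
    have p2: "pull K2 i2 p \<in> based_maps K2 Z2" by (rule pull_in_based_maps[OF p]) (use i2 Z in auto)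
    \<comment> \<open>On \<open>A1\<close> the pasted value is that of \<open>p\<close> at
      \<open>i1 (r1 x)\<close>, on the rest that at \<open>i2 (r2 x)\<close>; in both cases the
      point is \<open>H 0 x\<close>.\<close>
    have "restrict (\<lambda>x. if x \<in> A1 then snd (pull K1 i1 p) (r1 x) else snd (pull K2 i2 p) (r2 x)) K
       = restrict (snd p \<circ> H 0) K"
      using A r1 r2 H(5,6) by (intro restrict_ext) (auto simp: snd_pull image_subset_iff)
    then show ?thesis by (simp only: glue_def prod.case pull_def[of K "H 0"])
  qed
  have "homotopic_with (\<lambda>x. True) ?Y ?Y (?f \<circ> ?g) id"
    by (rule homotopic_with_equal[OF TrueI TrueI continuous_map_compose[OF cg cf]]) (simp only: o_apply fg id_apply)
  moreover have "homotopic_with (\<lambda>x. True) ?X ?X (?g \<circ> ?f) id"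
  proof -
    have "continuous_map (prod_topology (top_of_set {0..1::real}) ?X) ?X (\<lambda>(t, p). pull K (H t) p)"
      by (rule continuous_map_pull_homotopy) (use H Z in auto)
    moreover have "pull K (H 1) p = p" if "p \<in> based_maps K Z" for p
      by (rule pull_id[OF that]) (rule H(4))
    ultimately have "continuous_map (prod_topology (top_of_set {0..1::real}) ?X) ?X (\<lambda>(t, p). pull K (H t) p) \<and>
        (\<forall>p\<in>topspace ?X. (\<lambda>(t, p). pull K (H t) p) (0, p) = (?g \<circ> ?f) p) \<and>
        (\<forall>p\<in>topspace ?X. (\<lambda>(t, p). pull K (H t) p) (1, p) = id p) \<and> (\<forall>t\<in>{0..1::real}. True)"
      unfolding topspace_map_space o_apply prod.case id_apply using gf by metis
    then show ?thesis
      by (subst homotopic_with[OF refl]) (rule exI)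
  qed
  ultimately show ?thesis unfolding homotopy_equivalence_map_def using cf cg by blast
qed

end

section \<open>Cubes and their faces\<close>

text \<open>All the spaces \<open>X L\<close> share one carrier type, so the cubes of all shapes
  must live in \<open>nat => real\<close>. The pairing function turns block \<open>i\<close> and
  position \<open>j\<close> into one index.\<close>

definition coord :: "(nat \<Rightarrow> real) \<Rightarrow> nat \<Rightarrow> nat \<Rightarrow> real" where
  "coord x i j = x (prod_encode (i, j))"

definition point_of :: "nat \<Rightarrow> nat list \<Rightarrow> (nat \<Rightarrow> nat \<Rightarrow> real) \<Rightarrow> nat \<Rightarrow> real" where
  "point_of n L g = (\<lambda>(i, j). if i < n \<and> j < L ! i then g i j else 0) \<circ> prod_decode"

text \<open>The zeros outside the blocks make a point of the cube determined by its block
  coordinates and leave a product of compact sets.\<close>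

definition cube :: "nat \<Rightarrow> nat list \<Rightarrow> (nat \<Rightarrow> real) set" where
  "cube n L = {x. \<forall>i j. coord x i j \<in> (if i < n \<and> j < L ! i then {0..1} else {0})}"

text \<open>For \<open>a = 0\<close> the condition is vacuous: the only point of the 0-cube is a
  vertex. Hence an empty block makes the whole cube based and leaves only the constant map.\<close>

definition is_vertex :: "nat \<Rightarrow> (nat \<Rightarrow> real) \<Rightarrow> bool" where
  "is_vertex a v \<longleftrightarrow> v \<in> {..<a} \<rightarrow> {0, 1} \<and> mono_on {..<a} v"

definition cube_base :: "nat \<Rightarrow> nat list \<Rightarrow> (nat \<Rightarrow> real) set" where
  "cube_base n L = {x \<in> cube n L. \<exists>i<n. is_vertex (L ! i) (coord x i)}"

lemma coord_point_of [simp]: "coord (point_of n L g) i j = (if i < n \<and> j < L ! i then g i j else 0)"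
  by (simp add: coord_def point_of_def)

lemma coord_eqI: "(\<And>i j. coord x i j = coord y i j) \<Longrightarrow> x = y"
  unfolding coord_def by (metis ext prod_decode_inverse surj_pair)

lemma coord_cube_out: "\<lbrakk>x \<in> cube n L; \<not> (i < n \<and> j < L ! i)\<rbrakk> \<Longrightarrow> coord x i j = 0"
  unfolding cube_def by (drule CollectD, drule spec[of _ i], drule spec[of _ j]) (simp split: if_splits)

lemma coord_cube_bounds: "x \<in> cube n L \<Longrightarrow> 0 \<le> coord x i j \<and> coord x i j \<le> 1"
  unfolding cube_def by (drule CollectD, drule spec[of _ i], drule spec[of _ j]) (simp split: if_splits)

lemma point_of_in_cube:
  "(\<And>i j. \<lbrakk>i < n; j < L ! i\<rbrakk> \<Longrightarrow> 0 \<le> g i j \<and> g i j \<le> 1) \<Longrightarrow> point_of n L g \<in> cube n L"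
  by (simp add: cube_def)

lemma point_of_eqI:
  "\<lbrakk>x \<in> cube n L; \<And>i j. \<lbrakk>i < n; j < L ! i\<rbrakk> \<Longrightarrow> g i j = coord x i j\<rbrakk> \<Longrightarrow> point_of n L g = x"
  by (rule coord_eqI) (auto simp: coord_cube_out)

text \<open>Tychonoff: over the encoded indices the cube is a full product of intervals and
  singletons, and \<open>nat => real\<close> carries the product topology.\<close>

lemma compact_cube: "compact (cube n L)"
proof -
  let ?S = "\<lambda>k. if fst (prod_decode k) < n \<and> snd (prod_decode k) < L ! fst (prod_decode k) then {0..1::real} else {0}"
  have "compactin (product_topology (\<lambda>i. euclidean) UNIV) (PiE UNIV ?S)"
    by (subst compactin_PiE) auto
  moreover have "PiE UNIV ?S = cube n L"
  proof -
    have "(\<forall>k. x k \<in> ?S k) \<longleftrightarrow> (\<forall>i j. x (prod_encode (i, j)) \<in> ?S (prod_encode (i, j)))" for x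
      by (metis prod_decode_inverse surj_pair)
    moreover have "x \<in> cube n L \<longleftrightarrow> (\<forall>i j. x (prod_encode (i, j)) \<in> ?S (prod_encode (i, j)))" for x
      by (simp only: cube_def coord_def prod_encode_inverse fst_conv snd_conv mem_Collect_eq)
    moreover have "x \<in> PiE UNIV ?S \<longleftrightarrow> (\<forall>k. x k \<in> ?S k)" for x
      by (simp only: PiE_UNIV_domain Pi_iff ball_UNIV)
    ultimately show ?thesis by (intro set_eqI) (simp only:)
  qed
  ultimately show ?thesis by (simp add: euclidean_product_topology)
qed

lemma cube_base_subset: "cube_base n L \<subseteq> cube n L"
  by (auto simp: cube_base_def)

lemma continuous_on_coord:
  "continuous_on S f \<Longrightarrow> continuous_on S (\<lambda>x. coord (f x) i j)"
  unfolding coord_def by (rule continuous_on_product_then_coordinatewise)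

lemma continuous_on_If_const:
  "\<lbrakk>c \<Longrightarrow> continuous_on S f; \<not> c \<Longrightarrow> continuous_on S g\<rbrakk> \<Longrightarrow> continuous_on S (\<lambda>x. if c then f x else g x)"
  by (cases c) simp_all

lemma continuous_on_point_of:
  assumes "\<And>i j. \<lbrakk>i < n; j < L ! i\<rbrakk> \<Longrightarrow> continuous_on S (\<lambda>x. g x i j)"
  shows "continuous_on S (\<lambda>x. point_of n L (g x))"
proof (rule continuous_on_coordinatewise_then_product)
  fix k
  obtain i j where "prod_decode k = (i, j)" by (rule prod.exhaust)
  then have "(\<lambda>x. point_of n L (g x) k) = (\<lambda>x. if i < n \<and> j < L ! i then g x i j else 0)"
    by (simp add: point_of_def)
  moreover have "continuous_on S (\<lambda>x. if i < n \<and> j < L ! i then g x i j else 0)"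
    by (intro continuous_on_If_const assms continuous_on_const) auto
  ultimately show "continuous_on S (\<lambda>x. point_of n L (g x) k)" by (simp only:)
qed

lemma is_vertex_cong: "(\<And>j. j < a \<Longrightarrow> v j = w j) \<Longrightarrow> is_vertex a v \<longleftrightarrow> is_vertex a w"
  by (auto simp: is_vertex_def monotone_on_def Pi_iff)

lemma is_vertex_compose: "\<lbrakk>is_vertex m v; delta_hom k m \<phi>\<rbrakk> \<Longrightarrow> is_vertex k (\<lambda>j. v (\<phi> j))"
  by (auto simp: is_vertex_def delta_hom_def monotone_on_def Pi_iff PiE_iff)

definition simplicial_map :: "nat \<Rightarrow> nat list \<Rightarrow> (nat \<Rightarrow> nat) list \<Rightarrow> (nat \<Rightarrow> real) \<Rightarrow> nat \<Rightarrow> real" where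
  "simplicial_map n L fs y = point_of n L (\<lambda>i j. coord y i ((fs ! i) j))"

definition front_face :: "nat \<Rightarrow> nat list \<Rightarrow> nat \<Rightarrow> nat \<Rightarrow> nat \<Rightarrow> (nat \<Rightarrow> real) \<Rightarrow> nat \<Rightarrow> real" where
  "front_face n L i a b y =
     point_of n (L[i := a + b]) (\<lambda>i' j. if i' = i \<and> a \<le> j then 1 else coord y i' j)"

definition back_face :: "nat \<Rightarrow> nat list \<Rightarrow> nat \<Rightarrow> nat \<Rightarrow> nat \<Rightarrow> (nat \<Rightarrow> real) \<Rightarrow> nat \<Rightarrow> real" where
  "back_face n L i a b y =
     point_of n (L[i := a + b])
       (\<lambda>i' j. if i' = i then if j < a then 0 else coord y i' (j - a) else coord y i' j)"

lemma continuous_on_simplicial_map: "continuous_on S (simplicial_map n L fs)"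
  unfolding simplicial_map_def[abs_def]
  by (intro continuous_on_point_of continuous_on_coord continuous_on_id)

lemmas coord_continuity = continuous_on_point_of continuous_on_If_const continuous_on_const
  continuous_on_coord continuous_on_max continuous_on_min continuous_on_add continuous_on_diff
  continuous_on_mult continuous_on_id continuous_on_fst continuous_on_snd

lemma continuous_on_front_face: "continuous_on S (front_face n L i a b)"
  unfolding front_face_def[abs_def]
  by (intro coord_continuity)

lemma continuous_on_back_face: "continuous_on S (back_face n L i a b)"
  unfolding back_face_def[abs_def]
  by (intro coord_continuity)

lemma simplicial_map_in_cube: "y \<in> cube n M \<Longrightarrow> simplicial_map n L fs y \<in> cube n L"
  unfolding simplicial_map_def by (rule point_of_in_cube) (rule coord_cube_bounds)

lemma front_face_in_cube: "y \<in> cube n M \<Longrightarrow> front_face n L i a b y \<in> cube n (L[i := a + b])"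
  unfolding front_face_def by (rule point_of_in_cube) (auto simp: coord_cube_bounds)

lemma back_face_in_cube: "y \<in> cube n M \<Longrightarrow> back_face n L i a b y \<in> cube n (L[i := a + b])"
  unfolding back_face_def by (rule point_of_in_cube) (auto simp: coord_cube_bounds)

lemma simplicial_map_base:
  assumes "deltan_hom n L M fs" "y \<in> cube_base n M"
  shows "simplicial_map n L fs y \<in> cube_base n L"
proof -
  obtain i where i: "i < n" "is_vertex (M ! i) (coord y i)"
    using assms by (auto simp: cube_base_def)
  then have "is_vertex (L ! i) (\<lambda>j. coord y i ((fs ! i) j))"
    using assms(1) is_vertex_compose[of "M ! i" "coord y i" "L ! i" "fs ! i"] by (simp add: deltan_hom_def)
  moreover have "is_vertex (L ! i) (coord (simplicial_map n L fs y) i) \<longleftrightarrow>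
      is_vertex (L ! i) (\<lambda>j. coord y i ((fs ! i) j))"
    by (rule is_vertex_cong) (simp add: simplicial_map_def i)
  ultimately show ?thesis
    using simplicial_map_in_cube assms(2) i by (auto simp: cube_base_def)
qed

text \<open>A monotone string of zeros and ones stays monotone when ones are appended; a vertex in
  another block is not touched.\<close>

lemma front_face_base:
  assumes L: "length L = n" "i < n" and y: "y \<in> cube_base n (L[i := a])"
  shows "front_face n L i a b y \<in> cube_base n (L[i := a + b])"
proof -
  obtain k where k: "k < n" "is_vertex (L[i := a] ! k) (coord y k)"
    using y by (auto simp: cube_base_def)
  have "is_vertex (L[i := a + b] ! k) (coord (front_face n L i a b y) k)"
  proof (cases "k = i")
    case True
    then have v: "is_vertex a (coord y i)" using k L by simp
    have "coord y i j \<le> 1" for j using y coord_cube_bounds by (auto simp: cube_base_def)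
    then show ?thesis
      using True v L by (auto simp: is_vertex_def front_face_def monotone_on_def Pi_iff)
  next
    case False
    then show ?thesis
      using k L by (subst is_vertex_cong[where w = "coord y k"]) (auto simp: front_face_def)
  qed
  then show ?thesis using front_face_in_cube y k by (auto simp: cube_base_def)
qed

text \<open>Likewise for zeros put in front of the string.\<close>

lemma back_face_base:
  assumes L: "length L = n" "i < n" and y: "y \<in> cube_base n (L[i := b])"
  shows "back_face n L i a b y \<in> cube_base n (L[i := a + b])"
proof -
  obtain k where k: "k < n" "is_vertex (L[i := b] ! k) (coord y k)"
    using y by (auto simp: cube_base_def)
  have "is_vertex (L[i := a + b] ! k) (coord (back_face n L i a b y) k)"
  proof (cases "k = i")
    case True
    then have v: "is_vertex b (coord y i)" using k L by simp
    have "0 \<le> coord y i j" for j using y coord_cube_bounds by (auto simp: cube_base_def)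
    then show ?thesis
      using True v L by (auto simp: is_vertex_def back_face_def monotone_on_def Pi_iff)
  next
    case False
    then show ?thesis
      using k L by (subst is_vertex_cong[where w = "coord y k"]) (auto simp: back_face_def)
  qed
  then show ?thesis using back_face_in_cube y k by (auto simp: cube_base_def)
qed

section \<open>Deformation of the cube onto its front and back face\<close>

definition front_size :: "nat \<Rightarrow> nat \<Rightarrow> (nat \<Rightarrow> real) \<Rightarrow> real" where
  "front_size i a x = (\<Sum>j<a. coord x i j)"

text \<open>On the cube, \<open>front_size\<close> and \<open>back_size\<close> are the l1 distances
  of the front half of block \<open>i\<close> from all zeros and of the back half from all ones. So
  \<open>back_size\<close> vanishes on the front face and \<open>front_size\<close> on the back
  face.\<close>

definition back_size :: "nat \<Rightarrow> nat \<Rightarrow> nat \<Rightarrow> (nat \<Rightarrow> real) \<Rightarrow> real" where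
  "back_size i a b x = (\<Sum>j<b. 1 - coord x i (a + j))"

lemma coord_le_front_size: "\<lbrakk>x \<in> cube n L; j < a\<rbrakk> \<Longrightarrow> coord x i j \<le> front_size i a x"
  unfolding front_size_def by (rule member_le_sum) (auto simp: coord_cube_bounds)

lemma coord_ge_back_size: 
  assumes "x \<in> cube n L" "a \<le> j" "j < a + b"
  shows "1 - coord x i j \<le> back_size i a b x"
proof -
  have "1 - coord x i (a + (j - a)) \<le> back_size i a b x"
    unfolding back_size_def by (rule member_le_sum) (use assms in \<open>auto simp: coord_cube_bounds\<close>)
  then show ?thesis using assms by simp
qed

lemma front_size_nonneg: "x \<in> cube n L \<Longrightarrow> 0 \<le> front_size i a x"
  unfolding front_size_def by (rule sum_nonneg) (simp add: coord_cube_bounds)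

lemma back_size_nonneg: "x \<in> cube n L \<Longrightarrow> 0 \<le> back_size i a b x"
  unfolding back_size_def by (rule sum_nonneg) (simp add: coord_cube_bounds)

lemma continuous_on_front_size:
  "continuous_on S f \<Longrightarrow> continuous_on S (\<lambda>x. front_size i a (f x))"
  unfolding front_size_def by (intro continuous_on_sum continuous_on_diff continuous_on_const continuous_on_coord)

lemma continuous_on_back_size:
  "continuous_on S f \<Longrightarrow> continuous_on S (\<lambda>x. back_size i a b (f x))"
  unfolding back_size_def by (intro continuous_on_sum continuous_on_diff continuous_on_const continuous_on_coord)

text \<open>\<open>front_part\<close> and \<open>back_part\<close> are the coordinates, within the
  smaller cubes, of the point to which \<open>push\<close> at time 0 retracts \<open>x\<close>; they
  become \<open>r1\<close> and \<open>r2\<close> of \<open>wedge_data\<close>.\<close>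

definition front_part :: "nat \<Rightarrow> nat list \<Rightarrow> nat \<Rightarrow> nat \<Rightarrow> nat \<Rightarrow> (nat \<Rightarrow> real) \<Rightarrow> nat \<Rightarrow> real" where
  "front_part n L i a b x = point_of n (L[i := a])
     (\<lambda>i' j. if i' = i then max 0 (coord x i' j - back_size i a b x) else coord x i' j)"

definition back_part :: "nat \<Rightarrow> nat list \<Rightarrow> nat \<Rightarrow> nat \<Rightarrow> nat \<Rightarrow> (nat \<Rightarrow> real) \<Rightarrow> nat \<Rightarrow> real" where
  "back_part n L i a b x = point_of n (L[i := b])
     (\<lambda>i' j. if i' = i then min 1 (coord x i' (a + j) + front_size i a x) else coord x i' j)"

text \<open>At \<^term>\<open>t = 0\<close> this is a retraction onto the union of the front and the back face: if some
  coordinate in the front block exceeds \<^term>\<open>back_size i a b x\<close>, so does their sum, which pushes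
  every coordinate in the back block up to \<^term>\<open>1::real\<close>.\<close>
definition push :: "nat \<Rightarrow> nat list \<Rightarrow> nat \<Rightarrow> nat \<Rightarrow> nat \<Rightarrow> real \<Rightarrow> (nat \<Rightarrow> real) \<Rightarrow> nat \<Rightarrow> real" where
  "push n L i a b t x = point_of n (L[i := a + b])
     (\<lambda>i' j. if i' = i then t * coord x i' j + (1 - t) *
          (if j < a then max 0 (coord x i' j - back_size i a b x) else min 1 (coord x i' j + front_size i a x))
        else coord x i' j)"

lemma continuous_on_front_part: "continuous_on S (front_part n L i a b)"
  unfolding front_part_def[abs_def]
  by (intro coord_continuity continuous_on_front_size continuous_on_back_size)

lemma continuous_on_back_part: "continuous_on S (back_part n L i a b)"
  unfolding back_part_def[abs_def]
  by (intro coord_continuity continuous_on_front_size continuous_on_back_size)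

lemma continuous_on_push: "continuous_on S (\<lambda>(t, x). push n L i a b t x)"
  unfolding push_def[abs_def] case_prod_unfold
  by (intro coord_continuity continuous_on_front_size continuous_on_back_size)

lemma front_part_in_cube:
  assumes x: "x \<in> cube n M" shows "front_part n L i a b x \<in> cube n (L[i := a])"
  unfolding front_part_def
proof (rule point_of_in_cube)
  fix i' j
  show "0 \<le> (if i' = i then max 0 (coord x i' j - back_size i a b x) else coord x i' j) \<and>
      (if i' = i then max 0 (coord x i' j - back_size i a b x) else coord x i' j) \<le> 1"
    using coord_cube_bounds[OF x, of i' j] back_size_nonneg[OF x, of i a b] by auto
qed

lemma back_part_in_cube:
  assumes x: "x \<in> cube n M" shows "back_part n L i a b x \<in> cube n (L[i := b])"
  unfolding back_part_def
proof (rule point_of_in_cube)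
  fix i' j
  show "0 \<le> (if i' = i then min 1 (coord x i' (a + j) + front_size i a x) else coord x i' j) \<and>
      (if i' = i then min 1 (coord x i' (a + j) + front_size i a x) else coord x i' j) \<le> 1"
    using coord_cube_bounds[OF x, of i' j] coord_cube_bounds[OF x, of i' "a + j"]
      front_size_nonneg[OF x, of i a] by auto
qed

lemma push_in_cube:
  assumes x: "x \<in> cube n M" and t: "t \<in> {0..1}"
  shows "push n L i a b t x \<in> cube n (L[i := a + b])"
  unfolding push_def
proof (rule point_of_in_cube)
  fix i' j
  let ?d = "if j < a then max 0 (coord x i' j - back_size i a b x) else min 1 (coord x i' j + front_size i a x)"
  have c: "0 \<le> coord x i' j" "coord x i' j \<le> 1"
    using coord_cube_bounds[OF x, of i' j] by auto
  have d: "0 \<le> ?d" "?d \<le> 1"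
    using c front_size_nonneg[OF x, of i a] back_size_nonneg[OF x, of i a b] by auto
  have "0 \<le> t * coord x i' j + (1 - t) * ?d" using c d t by simp
  moreover have "t * coord x i' j + (1 - t) * ?d \<le> 1"
    by (rule convex_bound_le) (use c d t in auto)
  ultimately show "0 \<le> (if i' = i then t * coord x i' j + (1 - t) * ?d else coord x i' j) \<and>
      (if i' = i then t * coord x i' j + (1 - t) * ?d else coord x i' j) \<le> 1"
    using c by (simp only: split: if_split) blast
qed

text \<open>A one in the front half forces ones throughout the back half by monotonicity; otherwise
  the front half is zero. So every vertex of the block lies on one of the two faces, where
  \<open>push\<close> is stationary.\<close>

lemma vertex_sizes:
  assumes "is_vertex (a + b) (coord x i)"
  shows "front_size i a x = 0 \<or> back_size i a b x = 0"
proof -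
  have v: "coord x i j = 0 \<or> coord x i j = 1" if "j < a + b" for j
    using assms that by (auto simp: is_vertex_def dest!: funcset_mem)
  show ?thesis
  proof (cases "\<exists>j<a. coord x i j = 1")
    case True
    then obtain j where j: "j < a" "coord x i j = 1" by auto
    have "coord x i (a + k) = 1" if "k < b" for k
    proof -
      have "coord x i j \<le> coord x i (a + k)"
        using assms j that mono_onD[of "{..<a + b}" "coord x i" j "a + k"] by (simp add: is_vertex_def)
      then show ?thesis using j v[of "a + k"] that by auto
    qed
    then show ?thesis by (simp add: back_size_def)
  next
    case False
    then have "coord x i j = 0" if "j < a" for j
      using that v[of j] by auto
    then show ?thesis by (simp add: front_size_def)
  qed
qed

lemma sizes_zero_coord:
  assumes x: "x \<in> cube n L"
  shows "front_size i a x = 0 \<Longrightarrow> j < a \<Longrightarrow> coord x i j = 0"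
    and "back_size i a b x = 0 \<Longrightarrow> a \<le> j \<Longrightarrow> j < a + b \<Longrightarrow> coord x i j = 1"
  using coord_le_front_size[OF x, of j a i] coord_ge_back_size[OF x, of a j b i] coord_cube_bounds[OF x, of i j]
  by auto

text \<open>If one size is zero, the half it would shift keeps its coordinates, while the other half
  already consists of the extreme value at which the shift is truncated.\<close>

lemma push_fixes_wedge:
  assumes x: "x \<in> cube n (L[i := a + b])" and i: "i < n" and L: "length L = n"
    and "front_size i a x = 0 \<or> back_size i a b x = 0"
  shows "push n L i a b t x = x"
  unfolding push_def
proof (rule point_of_eqI[OF x])
  fix i' j assume "i' < n" "j < L[i := a + b] ! i'"
  then have "i' = i \<Longrightarrow> j < a + b" using i L by simp
  then show "(if i' = i then t * coord x i' j + (1 - t) *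
          (if j < a then max 0 (coord x i' j - back_size i a b x) else min 1 (coord x i' j + front_size i a x))
        else coord x i' j) = coord x i' j"
    using assms(4) sizes_zero_coord(1)[OF x, of i a j] sizes_zero_coord(2)[OF x, of i a b j]
      coord_cube_bounds[OF x, of i j] front_size_nonneg[OF x, of i a] back_size_nonneg[OF x, of i a b]
    by (auto simp: algebra_simps)
qed

lemma push_1: "x \<in> cube n (L[i := a + b]) \<Longrightarrow> push n L i a b 1 x = x"
  unfolding push_def by (rule point_of_eqI) auto

text \<open>A back coordinate \<open>c\<close> satisfies
  \<open>1 - c <= back_size <= front_size\<close>, so adding \<open>front_size\<close> and
  truncating gives 1.\<close>

lemma push_0_front:
  assumes x: "x \<in> cube n (L[i := a + b])" and i: "i < n" and L: "length L = n"
    and "back_size i a b x \<le> front_size i a x"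
  shows "push n L i a b 0 x = front_face n L i a b (front_part n L i a b x)"
proof (rule coord_eqI)
  fix i' j
  show "coord (push n L i a b 0 x) i' j = coord (front_face n L i a b (front_part n L i a b x)) i' j"
    using assms(4) L i coord_ge_back_size[OF x, of a j b i]
    by (auto simp: push_def front_face_def front_part_def nth_list_update)
qed

text \<open>Each front coordinate is at most \<open>front_size <= back_size\<close>, so subtracting
  \<open>back_size\<close> and truncating gives 0.\<close>

lemma push_0_back:
  assumes x: "x \<in> cube n (L[i := a + b])" and i: "i < n" and L: "length L = n"
    and "front_size i a x \<le> back_size i a b x"
  shows "push n L i a b 0 x = back_face n L i a b (back_part n L i a b x)"
proof (rule coord_eqI)
  fix i' j
  show "coord (push n L i a b 0 x) i' j = coord (back_face n L i a b (back_part n L i a b x)) i' j"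
    using assms(4) L i coord_le_front_size[OF x, of j a i]
    by (auto simp: push_def back_face_def back_part_def nth_list_update)
qed

text \<open>A vertex in block \<open>i\<close> makes the point stationary; a vertex in another block
  survives because only block \<open>i\<close> moves.\<close>

lemma push_base:
  assumes x: "x \<in> cube_base n (L[i := a + b])" and i: "i < n" and L: "length L = n" and t: "t \<in> {0..1}"
  shows "push n L i a b t x \<in> cube_base n (L[i := a + b])"
proof -
  have xc: "x \<in> cube n (L[i := a + b])" using x cube_base_subset by blast
  obtain k where k: "k < n" "is_vertex (L[i := a + b] ! k) (coord x k)"
    using x by (auto simp: cube_base_def)
  show ?thesis
  proof (cases "k = i")
    case True
    then have "push n L i a b t x = x"
      using k L i by (intro push_fixes_wedge[OF xc i L] vertex_sizes) simp
    then show ?thesis using x by simp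
  next
    case False
    then have "is_vertex (L[i := a + b] ! k) (coord (push n L i a b t x) k)"
      using k by (subst is_vertex_cong[where w = "coord x k"]) (auto simp: push_def)
    then show ?thesis using push_in_cube[OF xc t] k by (auto simp: cube_base_def)
  qed
qed

text \<open>For a vertex in block \<open>i\<close>, one of the sizes is zero, and the inequality
  makes it \<open>back_size\<close>. Then nothing is subtracted, and an initial segment of a vertex
  is a vertex.\<close>

lemma front_part_base:
  assumes x: "x \<in> cube_base n (L[i := a + b])" and i: "i < n" and L: "length L = n"
    and le: "back_size i a b x \<le> front_size i a x"
  shows "front_part n L i a b x \<in> cube_base n (L[i := a])"
proof -
  have xc: "x \<in> cube n (L[i := a + b])" using x cube_base_subset by blast
  obtain k where k: "k < n" "is_vertex (L[i := a + b] ! k) (coord x k)"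
    using x by (auto simp: cube_base_def)
  have "is_vertex (L[i := a] ! k) (coord (front_part n L i a b x) k)"
  proof (cases "k = i")
    case True
    then have v: "is_vertex (a + b) (coord x i)" using k L i by simp
    then have "back_size i a b x = 0"
      using vertex_sizes[OF v] le back_size_nonneg[OF xc, of i a b] by auto
    then have "is_vertex a (coord (front_part n L i a b x) i) \<longleftrightarrow> is_vertex a (coord x i)"
      using i L coord_cube_bounds[OF xc] by (intro is_vertex_cong) (auto simp: front_part_def)
    then show ?thesis using v True i L by (auto simp: is_vertex_def monotone_on_def)
  next
    case False
    then show ?thesis
      using k by (subst is_vertex_cong[where w = "coord x k"]) (auto simp: front_part_def)
  qed
  then show ?thesis using front_part_in_cube[OF xc] k by (auto simp: cube_base_def)
qed

lemma back_part_base: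
  assumes x: "x \<in> cube_base n (L[i := a + b])" and i: "i < n" and L: "length L = n"
    and le: "front_size i a x \<le> back_size i a b x"
  shows "back_part n L i a b x \<in> cube_base n (L[i := b])"
proof -
  have xc: "x \<in> cube n (L[i := a + b])" using x cube_base_subset by blast
  obtain k where k: "k < n" "is_vertex (L[i := a + b] ! k) (coord x k)"
    using x by (auto simp: cube_base_def)
  have "is_vertex (L[i := b] ! k) (coord (back_part n L i a b x) k)"
  proof (cases "k = i")
    case True
    then have v: "is_vertex (a + b) (coord x i)" using k L i by simp
    then have "front_size i a x = 0"
      using vertex_sizes[OF v] le front_size_nonneg[OF xc, of i a] by auto
    then have "is_vertex b (coord (back_part n L i a b x) i) \<longleftrightarrow> is_vertex b (\<lambda>j. coord x i (a + j))"
      using i L coord_cube_bounds[OF xc] by (intro is_vertex_cong) (auto simp: back_part_def)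
    then show ?thesis using v True i L by (auto simp: is_vertex_def monotone_on_def Pi_iff)
  next
    case False
    then show ?thesis
      using k by (subst is_vertex_cong[where w = "coord x k"]) (auto simp: back_part_def)
  qed
  then show ?thesis using back_part_in_cube[OF xc] k by (auto simp: cube_base_def)
qed

text \<open>When the sizes agree, the front half is lowered to all zeros and the back half raised to
  all ones. Constant strings are vertices; this is the vertex in which the two faces meet.\<close>

lemma parts_overlap:
  assumes x: "x \<in> cube n (L[i := a + b])" and i: "i < n" and L: "length L = n"
    and eq: "front_size i a x = back_size i a b x"
  shows "front_part n L i a b x \<in> cube_base n (L[i := a])"
    and "back_part n L i a b x \<in> cube_base n (L[i := b])"
proof -
  have "coord (front_part n L i a b x) i j = 0" if "j < a" for j
    using that i L eq coord_le_front_size[OF x that, of i] by (simp add: front_part_def)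
  then have "is_vertex a (coord (front_part n L i a b x) i)"
    by (simp add: is_vertex_def monotone_on_def)
  then show "front_part n L i a b x \<in> cube_base n (L[i := a])"
    using front_part_in_cube[OF x] i L by (auto simp: cube_base_def)
  have "coord (back_part n L i a b x) i j = 1" if "j < b" for j
    using that i L eq coord_ge_back_size[OF x, of a "a + j" b i] by (simp add: back_part_def)
  then have "is_vertex b (coord (back_part n L i a b x) i)"
    by (simp add: is_vertex_def monotone_on_def)
  then show "back_part n L i a b x \<in> cube_base n (L[i := b])"
    using back_part_in_cube[OF x] i L by (auto simp: cube_base_def)
qed

lemma front_face_sizes:
  assumes y: "y \<in> cube n (L[i := a])" and i: "i < n" and L: "length L = n"
  shows "back_size i a b (front_face n L i a b y) = 0"
    and "front_part n L i a b (front_face n L i a b y) = y"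
proof -
  show 0: "back_size i a b (front_face n L i a b y) = 0"
    using i L by (simp add: back_size_def front_face_def)
  show "front_part n L i a b (front_face n L i a b y) = y"
    unfolding front_part_def 0
    by (rule point_of_eqI[OF y]) (use i L coord_cube_bounds[OF y] in \<open>auto simp: front_face_def nth_list_update split: if_splits\<close>)
qed

lemma back_face_sizes:
  assumes y: "y \<in> cube n (L[i := b])" and i: "i < n" and L: "length L = n"
  shows "front_size i a (back_face n L i a b y) = 0"
    and "back_part n L i a b (back_face n L i a b y) = y"
proof -
  show 0: "front_size i a (back_face n L i a b y) = 0"
    using i L by (simp add: front_size_def back_face_def)
  show "back_part n L i a b (back_face n L i a b y) = y"
    unfolding back_part_def 0
    by (rule point_of_eqI[OF y]) (use i L coord_cube_bounds[OF y] in \<open>auto simp: back_face_def nth_list_update split: if_splits\<close>)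
qed

section \<open>The algebra of cube maps\<close>

context based_space
begin

definition cube_space :: "nat \<Rightarrow> nat list \<Rightarrow> ((nat \<Rightarrow> real) \<times> ((nat \<Rightarrow> real) \<Rightarrow> 'b)) topology" where
  "cube_space n L = map_space (cube n L) (cube_base n L)"

definition cube_map :: "nat \<Rightarrow> nat list \<Rightarrow> nat list \<Rightarrow> (nat \<Rightarrow> nat) list \<Rightarrow>
    (nat \<Rightarrow> real) \<times> ((nat \<Rightarrow> real) \<Rightarrow> 'b) \<Rightarrow> (nat \<Rightarrow> real) \<times> ((nat \<Rightarrow> real) \<Rightarrow> 'b)" where
  "cube_map n L M fs = pull (cube n M) (simplicial_map n L fs)"

definition cube_split :: "nat \<Rightarrow> nat \<Rightarrow> nat list \<Rightarrow> nat \<Rightarrow> nat \<Rightarrow>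
    (nat \<Rightarrow> real) \<times> ((nat \<Rightarrow> real) \<Rightarrow> 'b) \<Rightarrow>
    ((nat \<Rightarrow> real) \<times> ((nat \<Rightarrow> real) \<Rightarrow> 'b)) \<times> ((nat \<Rightarrow> real) \<times> ((nat \<Rightarrow> real) \<Rightarrow> 'b))" where
  "cube_split n i L a b p = (pull (cube n (L[i := a])) (front_face n L i a b) p,
                             pull (cube n (L[i := b])) (back_face n L i a b) p)"

lemma topspace_cube_space [simp]: "topspace (cube_space n L) = based_maps (cube n L) (cube_base n L)"
  by (simp add: cube_space_def)

text \<open>Reduces an axiom of the algebra to a commuting square of maps of cubes.\<close>

lemma pull_pull_eqI:
  assumes "g ` K \<subseteq> K'" "g' ` K \<subseteq> K''" "\<And>x. x \<in> K \<Longrightarrow> h (g x) = h' (g' x)"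
  shows "pull K g (pull K' h p) = pull K g' (pull K'' h' p)"
  unfolding pull_pull[OF assms(1)] pull_pull[OF assms(2)] by (rule pull_cong) (simp add: assms(3))

lemma top_functor_cube_space: "top_functor n (cube_space n) (cube_map n)"
  unfolding top_functor_def
proof (intro conjI allI impI ballI)
  fix L show "cgh_space (cube_space n L)" unfolding cube_space_def by (rule cgh_map_space)
next
  fix L M fs assume f: "deltan_hom n L M fs"
  show "continuous_map (cube_space n L) (cube_space n M) (cube_map n L M fs)"
    unfolding cube_space_def cube_map_def
    by (rule continuous_map_pull)
      (use simplicial_map_in_cube simplicial_map_base[OF f] continuous_on_simplicial_map cube_base_subset in auto)
next
  fix L x assume "deltan_obj n L" and x: "x \<in> topspace (cube_space n L)"
  then have L: "length L = n" by (simp add: deltan_obj_def)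
  show "cube_map n L L (deltan_id L) x = x"
    unfolding cube_map_def
  proof (rule pull_id)
    fix y assume "y \<in> cube n L"
    then show "simplicial_map n L (deltan_id L) y = y"
      unfolding simplicial_map_def by (rule point_of_eqI) (use L in \<open>simp add: deltan_id_def delta_id_def\<close>)
  qed (use x in simp)
next
  fix L M P fs gs x assume f: "deltan_hom n L M fs" and g: "deltan_hom n M P gs"
  show "cube_map n L P (deltan_comp L gs fs) x = cube_map n M P gs (cube_map n L M fs x)"
  proof -
    \<comment> \<open>\<open>simplicial_map\<close> reverses composition and \<open>pull\<close>
      reverses it again, which makes the functor covariant.\<close>
    have "simplicial_map n L (deltan_comp L gs fs) y = simplicial_map n L fs (simplicial_map n M gs y)" for y
    proof (rule coord_eqI)
      fix i j
      have "(fs ! i) j < M ! i" if "i < n" "j < L ! i"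
        using f that by (auto simp: deltan_hom_def delta_hom_def)
      then show "coord (simplicial_map n L (deltan_comp L gs fs) y) i j
          = coord (simplicial_map n L fs (simplicial_map n M gs y)) i j"
        using f by (auto simp: simplicial_map_def deltan_comp_def delta_comp_def compose_def deltan_hom_def)
    qed
    then show ?thesis
      unfolding cube_map_def
      by (subst pull_pull) (auto simp: simplicial_map_in_cube o_def intro!: pull_cong)
  qed
qed

lemma cube_split_homotopy_equivalence:
  assumes i: "i < n" and L: "length L = n"
  shows "homotopy_equivalence_map (cube_space n (L[i := a + b]))
     (kprod (cube_space n (L[i := a])) (cube_space n (L[i := b]))) (cube_split n i L a b)"
proof -
  \<comment> \<open>The cube is divided according to which size dominates. The retraction sends the
    overlap to the common vertex, which is based in both faces.\<close>
  interpret wedge_data B b0 "cube n (L[i := a + b])"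
    "{x. back_size i a b x \<le> front_size i a x}" "{x. front_size i a x \<le> back_size i a b x}"
    "cube_base n (L[i := a + b])" "cube n (L[i := a])" "cube_base n (L[i := a])"
    "cube n (L[i := b])" "cube_base n (L[i := b])" "front_part n L i a b" "back_part n L i a b"
  proof
    show "closed {x. back_size i a b x \<le> front_size i a x}" "closed {x. front_size i a x \<le> back_size i a b x}"
      by (intro closed_Collect_le continuous_on_front_size continuous_on_back_size continuous_on_id)+
    show "front_part n L i a b x \<in> cube_base n (L[i := a]) \<and> back_part n L i a b x \<in> cube_base n (L[i := b])"
      if "x \<in> cube n (L[i := a + b])" "x \<in> {x. back_size i a b x \<le> front_size i a x}"
        "x \<in> {x. front_size i a x \<le> back_size i a b x}" for x
      using that parts_overlap[OF that(1) i L] by auto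
    show "front_part n L i a b ` cube n (L[i := a + b]) \<subseteq> cube n (L[i := a])"
      by (rule image_subsetI) (rule front_part_in_cube)
    show "back_part n L i a b ` cube n (L[i := a + b]) \<subseteq> cube n (L[i := b])"
      by (rule image_subsetI) (rule back_part_in_cube)
    show "cube n (L[i := a + b]) \<subseteq> {x. back_size i a b x \<le> front_size i a x} \<union> {x. front_size i a x \<le> back_size i a b x}"
      by auto
  qed (simp_all add: compact_cube continuous_on_front_part continuous_on_back_part cube_base_subset
      front_part_base[OF _ i L] back_part_base[OF _ i L])
  show ?thesis
    unfolding cube_space_def cube_split_def[abs_def]
  proof (rule homotopy_equivalence_map_wedge[where H = "push n L i a b"])
    show "front_face n L i a b ` cube n (L[i := a]) \<subseteq> cube n (L[i := a + b]) \<inter> {x. back_size i a b x \<le> front_size i a x}"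
    proof clarify
      fix y assume y: "y \<in> cube n (L[i := a])"
      have "front_face n L i a b y \<in> cube n (L[i := a + b])" using y by (rule front_face_in_cube)
      then show "front_face n L i a b y \<in> cube n (L[i := a + b]) \<inter> {x. back_size i a b x \<le> front_size i a x}"
        using front_face_sizes(1)[OF y i L] front_size_nonneg by auto
    qed
    show "back_face n L i a b ` cube n (L[i := b]) \<subseteq> cube n (L[i := a + b]) \<inter> {x. front_size i a x \<le> back_size i a b x}"
    proof clarify
      fix y assume y: "y \<in> cube n (L[i := b])"
      have "back_face n L i a b y \<in> cube n (L[i := a + b])" using y by (rule back_face_in_cube)
      then show "back_face n L i a b y \<in> cube n (L[i := a + b]) \<inter> {x. front_size i a x \<le> back_size i a b x}"
        using back_face_sizes(1)[OF y i L] back_size_nonneg by auto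
    qed
    show "front_face n L i a b ` cube_base n (L[i := a]) \<subseteq> cube_base n (L[i := a + b])"
      by (rule image_subsetI) (rule front_face_base[OF L i])
    show "back_face n L i a b ` cube_base n (L[i := b]) \<subseteq> cube_base n (L[i := a + b])"
      by (rule image_subsetI) (rule back_face_base[OF L i])
    show "push n L i a b t x \<in> cube n (L[i := a + b])" if "t \<in> {0..1}" "x \<in> cube n (L[i := a + b])" for t x
      using that(2,1) by (rule push_in_cube)
    show "push n L i a b t x \<in> cube_base n (L[i := a + b])"
      if "t \<in> {0..1}" "x \<in> cube_base n (L[i := a + b])" for t x
      using that(2) i L that(1) by (rule push_base)
  qed (simp_all add: front_face_sizes(2)[OF _ i L] back_face_sizes(2)[OF _ i L] push_1
      push_0_front[OF _ i L] push_0_back[OF _ i L]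
      continuous_on_front_face continuous_on_back_face continuous_on_push)
qed

text \<open>The empty block is vacuously a vertex, so every point of the cube is based and the space
  has the constant map as its only point.\<close>

lemma cube_space_zero:
  assumes i: "i < n" and L: "length L = n"
  shows "homotopy_equivalence_map (cube_space n (L[i := 0])) point_space (\<lambda>_. ())"
proof -
  let ?K = "cube n (L[i := 0])" and ?X = "cube_space n (L[i := 0])"
  have base: "cube_base n (L[i := 0]) = ?K"
    using i L by (auto simp: cube_base_def is_vertex_def intro!: exI[of _ i])
  define c :: "(nat \<Rightarrow> real) \<times> ((nat \<Rightarrow> real) \<Rightarrow> 'b)" where "c = (undefined, restrict (\<lambda>_. b0) ?K)"
  have "continuous_map (top_of_set ?K) B (restrict (\<lambda>_. b0) ?K)"
    by (rule continuous_map_eq[of _ _ "\<lambda>_. b0"]) (auto simp: b0_in)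
  then have c: "c \<in> topspace ?X"
    by (simp add: base c_def based_maps_def)
  have eq: "p = c" if "p \<in> topspace ?X" for p
    using that c by (auto simp: base intro!: based_maps_eqI[of p ?K ?K c]) (auto simp: based_maps_def)
  show ?thesis
    unfolding homotopy_equivalence_map_def
  proof (intro conjI exI[of _ "\<lambda>_. c"])
    show cf: "continuous_map ?X point_space (\<lambda>_. ())" by (simp add: point_space_def)
    show cg: "continuous_map point_space ?X (\<lambda>_. c)" using c by simp
    show "homotopic_with (\<lambda>x. True) ?X ?X ((\<lambda>_. c) \<circ> (\<lambda>_. ())) id"
      by (rule homotopic_with_equal[OF TrueI TrueI continuous_map_compose[OF cf cg]]) (use eq in force)
    show "homotopic_with (\<lambda>x. True) point_space point_space ((\<lambda>_. ()) \<circ> (\<lambda>_. c)) id"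
      by (rule homotopic_with_equal[OF TrueI TrueI continuous_map_compose[OF cg cf]]) simp
  qed
qed

lemma cube_split_natural:
  assumes i: "i < n" and f: "deltan_hom n L M fs" and \<phi>: "delta_hom a c \<phi>" and \<psi>: "delta_hom b d \<psi>"
  shows "cube_split n i M c d (cube_map n (L[i := a + b]) (M[i := c + d]) (fs[i := delta_sum a b c \<phi> \<psi>]) p) =
     map_prod (cube_map n (L[i := a]) (M[i := c]) (fs[i := \<phi>]))
              (cube_map n (L[i := b]) (M[i := d]) (fs[i := \<psi>])) (cube_split n i L a b p)"
proof -
  have len: "length L = n" "length M = n" "length fs = n" using f by (auto simp: deltan_hom_def)
  \<comment> \<open>These range bounds matter because \<open>point_of\<close> puts 0 at every
    position beyond the end of a block.\<close>
  have fs: "(fs ! k) j < M ! k" if "k < n" "j < L ! k" for k j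
    using f that by (auto simp: deltan_hom_def delta_hom_def)
  have \<phi>': "\<phi> j < c" if "j < a" for j using \<phi> that by (auto simp: delta_hom_def)
  have \<psi>': "\<psi> j < d" if "j < b" for j using \<psi> that by (auto simp: delta_hom_def)
  have 1: "simplicial_map n (L[i := a + b]) (fs[i := delta_sum a b c \<phi> \<psi>]) (front_face n M i c d y) =
      front_face n L i a b (simplicial_map n (L[i := a]) (fs[i := \<phi>]) y)" for y
  proof (rule coord_eqI)
    fix k j
    show "coord (simplicial_map n (L[i := a + b]) (fs[i := delta_sum a b c \<phi> \<psi>]) (front_face n M i c d y)) k j =
        coord (front_face n L i a b (simplicial_map n (L[i := a]) (fs[i := \<phi>]) y)) k j"
    proof (cases "k = i")
      case True
      then show ?thesis
        using i len \<phi>'[of j] \<psi>'[of "j - a"]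
        by (cases "j < a") (simp_all add: simplicial_map_def front_face_def delta_sum_def trans_less_add1)
    next
      case False
      then show ?thesis
        using i len fs[of k j] by (simp add: simplicial_map_def front_face_def)
    qed
  qed
  have 2: "simplicial_map n (L[i := a + b]) (fs[i := delta_sum a b c \<phi> \<psi>]) (back_face n M i c d y) =
      back_face n L i a b (simplicial_map n (L[i := b]) (fs[i := \<psi>]) y)" for y
  proof (rule coord_eqI)
    fix k j
    show "coord (simplicial_map n (L[i := a + b]) (fs[i := delta_sum a b c \<phi> \<psi>]) (back_face n M i c d y)) k j =
        coord (back_face n L i a b (simplicial_map n (L[i := b]) (fs[i := \<psi>]) y)) k j"
    proof (cases "k = i")
      case True
      then show ?thesis
        using i len \<phi>'[of j] \<psi>'[of "j - a"]
        by (cases "j < a") (auto simp: simplicial_map_def back_face_def delta_sum_def trans_less_add1)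
    next
      case False
      then show ?thesis
        using i len fs[of k j] by (simp add: simplicial_map_def back_face_def)
    qed
  qed
  show ?thesis
    unfolding cube_split_def cube_map_def map_prod_simp
    by (intro arg_cong2[where f = Pair] pull_pull_eqI image_subsetI)
      (simp_all only: front_face_in_cube back_face_in_cube simplicial_map_in_cube 1 2)
qed

text \<open>Both sides restrict to the same three faces of block \<open>i\<close>, namely
  \<open>(y,1,1)\<close>, \<open>(0,y,1)\<close> and \<open>(0,0,y)\<close>.\<close>

lemma cube_split_coassoc:
  assumes i: "i < n" and L: "length L = n"
  shows "map_prod id (cube_split n i L b c) (cube_split n i L a (b + c) p) =
     (\<lambda>((u, v), w). (u, (v, w))) (map_prod (cube_split n i L a b) id (cube_split n i L (a + b) c p))"
proof -
  have 1: "front_face n L i a (b + c) y = front_face n L i (a + b) c (front_face n L i a b y)" for y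
    by (rule coord_eqI) (use i L in \<open>auto simp: front_face_def nth_list_update\<close>)
  have 2: "back_face n L i a (b + c) (front_face n L i b c y) = front_face n L i (a + b) c (back_face n L i a b y)" for y
    by (rule coord_eqI) (use i L in \<open>auto simp: front_face_def back_face_def nth_list_update\<close>)
  have 3: "back_face n L i a (b + c) (back_face n L i b c y) = back_face n L i (a + b) c y" for y
    by (rule coord_eqI) (use i L in \<open>auto simp: back_face_def nth_list_update\<close>)
  have e1: "pull (cube n (L[i := a])) (front_face n L i a (b + c)) p =
      pull (cube n (L[i := a])) (front_face n L i a b) (pull (cube n (L[i := a + b])) (front_face n L i (a + b) c) p)"
    by (subst pull_pull) (auto simp: front_face_in_cube 1 intro!: pull_cong)
  have e2: "pull (cube n (L[i := b])) (front_face n L i b c) (pull (cube n (L[i := b + c])) (back_face n L i a (b + c)) p) =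
      pull (cube n (L[i := b])) (back_face n L i a b) (pull (cube n (L[i := a + b])) (front_face n L i (a + b) c) p)"
    by (rule pull_pull_eqI) (auto simp: front_face_in_cube back_face_in_cube 2)
  have e3: "pull (cube n (L[i := c])) (back_face n L i b c) (pull (cube n (L[i := b + c])) (back_face n L i a (b + c)) p) =
      pull (cube n (L[i := c])) (back_face n L i (a + b) c) p"
    by (subst pull_pull) (auto simp: back_face_in_cube 3 intro!: pull_cong)
  show ?thesis by (simp add: cube_split_def e1 e2 e3)
qed

lemma cube_split_counit:
  assumes i: "i < n" and L: "length L = n" and p: "p \<in> topspace (cube_space n (L[i := a]))"
  shows "fst (cube_split n i L a 0 p) = p" "snd (cube_split n i L 0 a p) = p"
proof -
  have "front_face n L i a 0 y = y" if "y \<in> cube n (L[i := a])" for y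
    unfolding front_face_def by (rule point_of_eqI) (use that i L in \<open>auto simp: nth_list_update\<close>)
  then show "fst (cube_split n i L a 0 p) = p"
    using p by (simp add: cube_split_def pull_id)
  have "back_face n L i 0 a y = y" if "y \<in> cube n (L[i := a])" for y
    unfolding back_face_def by (rule point_of_eqI) (use that i L in \<open>auto simp: nth_list_update\<close>)
  then show "snd (cube_split n i L 0 a p) = p"
    using p by (simp add: cube_split_def pull_id)
qed

text \<open>Face maps in different blocks write to disjoint sets of coordinates and so commute;
  there is one identity for each of the four choices of faces.\<close>

lemma cube_split_interchange:
  assumes ij: "i < j" "j < n" and L: "length L = n"
  shows "map_prod (cube_split n j (L[i := a]) b b') (cube_split n j (L[i := a']) b b')
      (cube_split n i (L[j := b + b']) a a' p) =
    (\<lambda>((z1, z2), (z3, z4)). ((z1, z3), (z2, z4)))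
      (map_prod (cube_split n i (L[j := b]) a a') (cube_split n i (L[j := b']) a a')
        (cube_split n j (L[i := a + a']) b b' p))"
proof -
  have sw: "L[j := x, i := y] = L[i := y, j := x]" for x y
    using ij by (simp add: list_update_swap)
  note defs = front_face_def back_face_def nth_list_update
  have 1: "front_face n (L[j := b + b']) i a a' (front_face n (L[i := a]) j b b' y) =
      front_face n (L[i := a + a']) j b b' (front_face n (L[j := b]) i a a' y)" for y
    by (rule coord_eqI) (use ij L in \<open>auto simp: defs\<close>)
  have 2: "front_face n (L[j := b + b']) i a a' (back_face n (L[i := a]) j b b' y) =
      back_face n (L[i := a + a']) j b b' (front_face n (L[j := b']) i a a' y)" for y
    by (rule coord_eqI) (use ij L in \<open>auto simp: defs\<close>)
  have 3: "back_face n (L[j := b + b']) i a a' (front_face n (L[i := a']) j b b' y) =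
      front_face n (L[i := a + a']) j b b' (back_face n (L[j := b]) i a a' y)" for y
    by (rule coord_eqI) (use ij L in \<open>auto simp: defs\<close>)
  have 4: "back_face n (L[j := b + b']) i a a' (back_face n (L[i := a']) j b b' y) =
      back_face n (L[i := a + a']) j b b' (back_face n (L[j := b']) i a a' y)" for y
    by (rule coord_eqI) (use ij L in \<open>auto simp: defs\<close>)
  have fc: "front_face n (L[j := c]) i d e y \<in> cube n (L[i := d + e, j := c])"
     "back_face n (L[j := c]) i d e y \<in> cube n (L[i := d + e, j := c])" if "y \<in> cube n M" for c d e y M
    using front_face_in_cube[OF that, of "L[j := c]" i d e] back_face_in_cube[OF that, of "L[j := c]" i d e]
    by (simp_all only: sw)
  show ?thesis
    unfolding cube_split_def map_prod_simp prod.case sw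
    by (intro arg_cong2[where f = Pair] pull_pull_eqI image_subsetI)
      (auto simp: 1 2 3 4 fc front_face_in_cube back_face_in_cube)
qed

theorem homotopy_mon_algebra_cube_space:
  "homotopy_mon_algebra n (cube_space n) (cube_map n) (cube_split n)"
proof -
  have split: "continuous_map (cube_space n (L[i := a + b]))
        (kprod (cube_space n (L[i := a])) (cube_space n (L[i := b]))) (cube_split n i L a b) \<and>
      homotopy_equivalence_map (cube_space n (L[i := a + b]))
        (kprod (cube_space n (L[i := a])) (cube_space n (L[i := b]))) (cube_split n i L a b)"
    if "i < n" "deltan_obj n L" for i a b and L :: "nat list"
    using cube_split_homotopy_equivalence[of i n L a b] that
    by (simp add: homotopy_equivalence_map_def deltan_obj_def)
  show ?thesis
    unfolding homotopy_mon_algebra_def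
  proof (intro conjI)
    show "\<forall>i L a b. i < n \<longrightarrow> deltan_obj n L \<longrightarrow>
      continuous_map (cube_space n (L[i := a + b]))
        (kprod (cube_space n (L[i := a])) (cube_space n (L[i := b]))) (cube_split n i L a b) \<and>
      homotopy_equivalence_map (cube_space n (L[i := a + b]))
        (kprod (cube_space n (L[i := a])) (cube_space n (L[i := b]))) (cube_split n i L a b)"
      by (intro allI impI) (rule split)
    show "top_functor n (cube_space n) (cube_map n)" by (rule top_functor_cube_space)
  qed ((intro allI impI ballI conjI)?, erule cube_space_zero cube_split_natural cube_split_coassoc
        cube_split_counit cube_split_interchange; simp only: deltan_obj_def)+
qed

end

section \<open>The unit cube modulo its boundary\<close>

lemma topspace_compact_open [simp]: "topspace (compact_open S B C) = C"
proof -
  have "C = {f \<in> C. f ` {} \<subseteq> topspace B}" by simp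
  then have "C \<in> {{f \<in> C. f ` K \<subseteq> U} | K U. compactin S K \<and> openin B U}"
    by (intro CollectI exI[of _ "{}"] exI[of _ "topspace B"]) auto
  then show ?thesis
    by (auto simp: compact_open_def topology_generated_by_topspace)
qed

lemma openin_compact_open:
  assumes "compactin S K" "openin B U"
  shows "openin (compact_open S B C) {f \<in> C. f ` K \<subseteq> U}"
  unfolding compact_open_def by (rule topology_generated_by_Basis) (use assms in auto)

lemma continuous_map_into_compact_open:
  assumes "\<And>x. x \<in> topspace T \<Longrightarrow> F x \<in> C"
    and "\<And>K U. \<lbrakk>compactin S K; openin B U\<rbrakk> \<Longrightarrow> openin T {x \<in> topspace T. F x ` K \<subseteq> U}"
  shows "continuous_map T (compact_open S B C) F"
  unfolding compact_open_def
proof (rule continuous_on_generated_topo)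
  fix V assume "V \<in> {{f \<in> C. f ` K \<subseteq> U} | K U. compactin S K \<and> openin B U}"
  then obtain K U where V: "V = {f \<in> C. f ` K \<subseteq> U}" and KU: "compactin S K" "openin B U" by auto
  have "F -` V \<inter> topspace T = {x \<in> topspace T. F x ` K \<subseteq> U}"
    using assms(1) V by auto
  then show "openin T (F -` V \<inter> topspace T)"
    using assms(2)[OF KU] by simp
next
  show "F ` topspace T \<subseteq> \<Union> {{f \<in> C. f ` K \<subseteq> U} | K U. compactin S K \<and> openin B U}"
    using assms(1) topspace_compact_open[of S B C] unfolding compact_open_def topology_generated_by_topspace by auto
qed

context based_space
begin

text \<open>A continuous map from a compact to a Hausdorff space is closed, so continuity passes
  from \<open>K\<close> down to \<open>S\<close>, which is \<open>K\<close> with \<open>Z\<close>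
  collapsed to \<open>s0\<close>. The point \<open>s0\<close> is exempt from surjectivity because
  \<open>Z\<close> may be empty: for \<open>n = 0\<close> a single point is mapped to the sphere of
  two points and misses the base point.\<close>

lemma map_space_homeomorphic_quotient:
  fixes K Z :: "'a::t2_space set" and S :: "'c topology" and q :: "'a \<Rightarrow> 'c"
  assumes K: "compact K" and S: "Hausdorff_space S" and Z: "Z \<subseteq> K" and s0: "s0 \<in> topspace S"
    and q: "continuous_map (top_of_set K) S q"
    and qZ: "\<And>x. x \<in> K \<Longrightarrow> q x = s0 \<longleftrightarrow> x \<in> Z"
    and inj: "inj_on q (K - Z)" and surj: "topspace S - {s0} \<subseteq> q ` K"
  shows "map_space K Z homeomorphic_space
    kification (compact_open S B {f. continuous_map S B f \<and> f s0 = b0 \<and> f \<in> extensional (topspace S)})"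
proof -
  define M where "M = {f. continuous_map S B f \<and> f s0 = b0 \<and> f \<in> extensional (topspace S)}"
  define F :: "('c \<Rightarrow> 'b) \<Rightarrow> 'a \<times> ('a \<Rightarrow> 'b)" where "F f = (undefined, restrict (f \<circ> q) K)" for f
  define G :: "'a \<times> ('a \<Rightarrow> 'b) \<Rightarrow> 'c \<Rightarrow> 'b"
    where "G p = restrict (\<lambda>y. if y = s0 then b0 else snd p (inv_into (K - Z) q y)) (topspace S)" for p
  have qS: "q x \<in> topspace S" if "x \<in> K" for x
    using q that by (auto simp: continuous_map_def)
  have Gq: "G p (q x) = snd p x" if "p \<in> based_maps K Z" "x \<in> K" for p x
    using that qZ[of x] qS[of x] inj by (auto simp: G_def based_maps_def inv_into_f_f)
  have Gs0: "G p s0 = b0" for p using s0 by (simp add: G_def)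
  have ex: "\<exists>x\<in>K. y = q x" if "y \<in> topspace S" "y \<noteq> s0" for y using surj that by auto
  have FM: "F f \<in> based_maps K Z" if "f \<in> M" for f
  proof -
    have "continuous_map (top_of_set K) B (f \<circ> q)"
      by (rule continuous_map_compose[OF q]) (use that in \<open>simp add: M_def\<close>)
    then have "continuous_map (top_of_set K) B (restrict (f \<circ> q) K)"
      by (rule continuous_map_eq) auto
    then show ?thesis using that Z qZ by (auto simp: F_def based_maps_def M_def)
  qed
  have cl: "closed_map (top_of_set K) S q"
    by (rule T1_Spaces.continuous_imp_closed_map[OF q _ S]) (simp add: K compact_space_subtopology)
  have GM: "G p \<in> M" if p: "p \<in> based_maps K Z" for p
  proof -
    have pc: "continuous_map (top_of_set K) B (snd p)" using p by (simp add: based_maps_def)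
    have "continuous_map S B (G p)"
      unfolding continuous_map_closedin
    proof (intro conjI allI impI)
      have "G p y \<in> topspace B" if y: "y \<in> topspace S" for y
      proof (cases "y = s0")
        case False
        then obtain x where "x \<in> K" "y = q x" using ex y by blast
        then show ?thesis using Gq[OF p] pc by (auto simp: continuous_map_def)
      qed (simp add: Gs0 b0_in)
      then show "G p \<in> topspace S \<rightarrow> topspace B" by blast
      fix C assume C: "closedin B C"
      \<comment> \<open>\<open>s0\<close> is added by hand, since it is not a value of
        \<open>q\<close> when \<open>Z\<close> is empty.\<close>
      have "{y \<in> topspace S. G p y \<in> C} = q ` {x \<in> topspace (top_of_set K). snd p x \<in> C} \<union> (if b0 \<in> C then {s0} else {})"
        (is "?L = ?R")
      proof (intro set_eqI iffI)
        fix y assume y: "y \<in> ?L"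
        show "y \<in> ?R"
        proof (cases "y = s0")
          case True then show ?thesis using y Gs0 by simp
        next
          case False
          then obtain x where "x \<in> K" "y = q x" using ex y by blast
          then show ?thesis using Gq[OF p] y by auto
        qed
      next
        fix y assume "y \<in> ?R"
        then show "y \<in> ?L" using Gq[OF p] qS Gs0[of p] s0 by (auto split: if_splits)
      qed
      moreover have "closedin S (q ` {x \<in> topspace (top_of_set K). snd p x \<in> C})"
        using cl closedin_continuous_map_preimage[OF pc C] by (simp add: closed_map_def)
      moreover have "closedin S (if b0 \<in> C then {s0} else {})"
        using closedin_Hausdorff_singleton[OF S s0] by simp
      ultimately show "closedin S {y \<in> topspace S. G p y \<in> C}" by (simp only: closedin_Un)
    qed
    then show ?thesis using Gs0 by (simp add: M_def) (simp add: G_def)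
  qed
  have FG: "F (G p) = p" if p: "p \<in> based_maps K Z" for p
    by (rule based_maps_eqI[OF FM[OF GM[OF p]] p]) (simp add: F_def Gq[OF p])
  have GF: "G (F f) = f" if f: "f \<in> M" for f
  proof (rule extensionalityI[of _ "topspace S"])
    show "G (F f) \<in> extensional (topspace S)" by (simp add: G_def)
    show "f \<in> extensional (topspace S)" using f by (simp add: M_def)
    fix y assume y: "y \<in> topspace S"
    show "G (F f) y = f y"
    proof (cases "y = s0")
      case True then show ?thesis using Gs0 f by (simp add: M_def)
    next
      case False
      then obtain x where "x \<in> K" "y = q x" using ex y by blast
      then show ?thesis using Gq[OF FM[OF f]] by (simp add: F_def)
    qed
  qed
  have cF: "continuous_map (compact_open S B M) (co_space K Z) F"
  proof (rule continuous_map_into_co_space)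
    fix C U assume C: "compactin (top_of_set K) C" and U: "openin B U"
    have "C \<subseteq> K" using C by (auto simp: compactin_subtopology)
    then have "{f \<in> topspace (compact_open S B M). snd (F f) ` C \<subseteq> U} = {f \<in> M. f ` (q ` C) \<subseteq> U}"
      by (auto simp: F_def subset_iff image_subset_iff)
    then show "openin (compact_open S B M) {f \<in> topspace (compact_open S B M). snd (F f) ` C \<subseteq> U}"
      using openin_compact_open[OF image_compactin[OF C q] U] by simp
  qed (simp add: FM)
  have cG: "continuous_map (co_space K Z) (compact_open S B M) G"
  proof (rule continuous_map_into_compact_open)
    fix C U assume C: "compactin S C" and U: "openin B U"
    have CS: "C \<subseteq> topspace S" using C by (simp add: compactin_subset_topspace)
    let ?D = "{x \<in> topspace (top_of_set K). q x \<in> C}"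
    \<comment> \<open>\<open>C\<close> is compact in a Hausdorff space, hence closed; its preimage
      is closed in the compact \<open>K\<close>.\<close>
    have D: "compactin (top_of_set K) ?D"
      by (intro closedin_compact_space closedin_continuous_map_preimage[OF q] compactin_imp_closedin[OF S C])
        (simp add: K compact_space_subtopology)
    show "openin (co_space K Z) {p \<in> topspace (co_space K Z). G p ` C \<subseteq> U}"
    \<comment> \<open>If \<open>s0\<close> lies in \<open>C\<close>, then \<open>b0\<close> has to
      lie in \<open>U\<close>, a condition that \<open>?D\<close> cannot see when no point of
      \<open>K\<close> lies over \<open>s0\<close>.\<close>
    proof (cases "s0 \<in> C \<and> b0 \<notin> U")
      case True
      then have "{p \<in> topspace (co_space K Z). G p ` C \<subseteq> U} = {}" using Gs0 by force
      then show ?thesis by (simp only: openin_empty)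
    next
      case False
      have eq: "G p ` C \<subseteq> U \<longleftrightarrow> snd p ` ?D \<subseteq> U" if p: "p \<in> based_maps K Z" for p
      proof
        assume l: "G p ` C \<subseteq> U"
        show "snd p ` ?D \<subseteq> U"
        proof (rule image_subsetI)
          fix x assume "x \<in> ?D"
          then show "snd p x \<in> U" using l Gq[OF p, of x] by auto
        qed
      next
        assume r: "snd p ` ?D \<subseteq> U"
        show "G p ` C \<subseteq> U"
        proof (rule image_subsetI)
          fix y assume y: "y \<in> C"
          show "G p y \<in> U"
          proof (cases "y = s0")
            case True then show ?thesis using False y Gs0 by auto
          next
            case False
            then obtain x where "x \<in> K" "y = q x" using ex y CS by blast
            then show ?thesis using Gq[OF p, of x] r y by auto
          qed
        qed
      qed
      have "{p \<in> topspace (co_space K Z). G p ` C \<subseteq> U} = {p \<in> based_maps K Z. snd p ` ?D \<subseteq> U}"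
        by (simp only: topspace_co_space eq cong: conj_cong)
      then show ?thesis using openin_co_space[OF D U] by simp
    qed
  qed (simp add: GM)
  have "homeomorphic_maps (map_space K Z) (kification (compact_open S B M)) G F"
    unfolding homeomorphic_maps_def map_space_def
    using continuous_map_kification[OF cF] continuous_map_kification[OF cG] FG GF by simp
  then show ?thesis unfolding homeomorphic_space_def M_def by blast
qed

end

section \<open>Wrapping the cube around the sphere\<close>

primrec sup_norm :: "nat \<Rightarrow> (nat \<Rightarrow> real) \<Rightarrow> real" where
  "sup_norm 0 y = 0"
| "sup_norm (Suc n) y = max (sup_norm n y) \<bar>y n\<bar>"

lemma sup_norm_nonneg: "0 \<le> sup_norm n y"
  by (induction n) auto

lemma abs_le_sup_norm: "i < n \<Longrightarrow> \<bar>y i\<bar> \<le> sup_norm n y"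
  by (induction n) (auto simp: less_Suc_eq)

lemma sup_norm_cases: "sup_norm n y = 0 \<or> (\<exists>i<n. sup_norm n y = \<bar>y i\<bar>)"
  by (induction n) (auto simp: less_Suc_eq max_def)

lemma sup_norm_scale: "0 \<le> c \<Longrightarrow> sup_norm n (\<lambda>i. c * y i) = c * sup_norm n y"
  by (induction n) (auto simp: abs_mult max_mult_distrib_left)

lemma sup_norm_cong: "(\<And>i. i < n \<Longrightarrow> y i = z i) \<Longrightarrow> sup_norm n y = sup_norm n z"
  by (induction n) auto

lemma continuous_on_sup_norm:
  "(\<And>i. continuous_on S (\<lambda>x. g x i)) \<Longrightarrow> continuous_on S (\<lambda>x. sup_norm n (g x))"
  by (induction n) (auto intro!: continuous_on_max continuous_on_rabs)

text \<open>Inverse stereographic projection of \<^term>\<open>\<lambda>i. y i / (1 - sup_norm n y)\<close>, a homeomorphism from the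
  open cube to Euclidean space, with denominators cleared so that it extends to the boundary.\<close>
definition wrap :: "nat \<Rightarrow> (nat \<Rightarrow> real) \<Rightarrow> nat \<Rightarrow> real" where
  "wrap n y k =
    (let s = \<Sum>i<n. (y i)\<^sup>2; r = 1 - sup_norm n y in
     case k of 0 \<Rightarrow> (s - r\<^sup>2) / (s + r\<^sup>2) | Suc i \<Rightarrow> if i < n then 2 * r * y i / (s + r\<^sup>2) else 0)"

lemma wrap_0: "wrap n y 0 = ((\<Sum>i<n. (y i)\<^sup>2) - (1 - sup_norm n y)\<^sup>2) / ((\<Sum>i<n. (y i)\<^sup>2) + (1 - sup_norm n y)\<^sup>2)"
  by (simp add: wrap_def Let_def)

lemma wrap_Suc: "wrap n y (Suc i) =
    (if i < n then 2 * (1 - sup_norm n y) * y i / ((\<Sum>i<n. (y i)\<^sup>2) + (1 - sup_norm n y)\<^sup>2) else 0)"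
  by (simp add: wrap_def Let_def)

text \<open>The first sum vanishes only when all the \<open>y i\<close> do, and then
  \<open>sup_norm n y = 0\<close> makes the second term 1. For \<open>n = 0\<close> this gives
  \<open>wrap 0 y 0 = -1\<close>, the point of the 0-sphere opposite to the base point.\<close>

lemma wrap_denominator_pos: "0 < (\<Sum>i<n. (y i)\<^sup>2) + (1 - sup_norm n y)\<^sup>2"
proof (cases "\<exists>i<n. y i \<noteq> 0")
  case True
  then obtain i where "i < n" "y i \<noteq> 0" by auto
  then have "0 < (\<Sum>i<n. (y i)\<^sup>2)" by (intro sum_pos2[of _ i]) auto
  then show ?thesis by (simp add: add_pos_nonneg)
next
  case False
  then have "sup_norm n y = 0" using sup_norm_cases[of n y] by auto
  then show ?thesis by (simp add: add_nonneg_pos sum_nonneg)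
qed

lemma wrap_in_nsphere: "wrap n y \<in> topspace (nsphere n)"
proof -
  define s where "s = (\<Sum>i<n. (y i)\<^sup>2)"
  define r where "r = 1 - sup_norm n y"
  have D: "s + r\<^sup>2 \<noteq> 0" using wrap_denominator_pos[of y n] by (simp add: s_def r_def)
  have "(\<Sum>k\<le>n. (wrap n y k)\<^sup>2) = (wrap n y 0)\<^sup>2 + (\<Sum>i<n. (wrap n y (Suc i))\<^sup>2)"
    by (rule sum.atMost_shift)
  also have "(\<Sum>i<n. (wrap n y (Suc i))\<^sup>2) = (\<Sum>i<n. (2 * r / (s + r\<^sup>2))\<^sup>2 * (y i)\<^sup>2)"
    by (rule sum.cong) (simp_all add: wrap_Suc s_def r_def power_mult_distrib power_divide)
  also have "\<dots> = (2 * r / (s + r\<^sup>2))\<^sup>2 * s"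
    by (simp add: s_def sum_distrib_left)
  also have "(wrap n y 0)\<^sup>2 + \<dots> = ((s - r\<^sup>2)\<^sup>2 + (2 * r)\<^sup>2 * s) / (s + r\<^sup>2)\<^sup>2"
    by (simp add: wrap_0 power_divide add_divide_distrib flip: s_def r_def)
  also have "(s - r\<^sup>2)\<^sup>2 + (2 * r)\<^sup>2 * s = (s + r\<^sup>2)\<^sup>2"
    by (simp add: power2_eq_square algebra_simps)
  finally have "(\<Sum>k\<le>n. (wrap n y k)\<^sup>2) = 1" using D by simp
  moreover have "wrap n y k = 0" if "n < k" for k
    using that by (cases k) (simp_all add: wrap_Suc)
  ultimately show ?thesis by (simp add: nsphere)
qed

text \<open>With \<open>r = 1 - sup_norm n y\<close>, the leading coordinate is 1 exactly for
  \<open>r = 0\<close>, and all other coordinates are multiples of \<open>r\<close>.\<close>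

lemma wrap_eq_base_iff: "wrap n y = sphere_base \<longleftrightarrow> sup_norm n y = 1"
proof
  assume "wrap n y = sphere_base"
  then have "wrap n y 0 = 1" by (simp add: sphere_base_def)
  then have "(\<Sum>i<n. (y i)\<^sup>2) - (1 - sup_norm n y)\<^sup>2 = (\<Sum>i<n. (y i)\<^sup>2) + (1 - sup_norm n y)\<^sup>2"
    using wrap_denominator_pos[of y n] by (simp add: wrap_0)
  then show "sup_norm n y = 1" by simp
next
  assume 1: "sup_norm n y = 1"
  then have "(\<Sum>i<n. (y i)\<^sup>2) \<noteq> 0" using wrap_denominator_pos[of y n] by simp
  then show "wrap n y = sphere_base"
    using 1 by (auto simp: fun_eq_iff sphere_base_def wrap_def Let_def split: nat.splits)
qed

lemma wrap_cong: "(\<And>i. i < n \<Longrightarrow> y i = z i) \<Longrightarrow> wrap n y = wrap n z"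
  using sup_norm_cong[of n y z] by (auto simp: wrap_def fun_eq_iff Let_def split: nat.splits)

text \<open>Projection from \<open>sphere_base\<close> divides by
  \<open>1 - wrap n y 0 = 2 * r^2 / (s + r^2)\<close>, and the common factor
  \<open>2 * r / (s + r^2)\<close> cancels.\<close>

lemma wrap_stereographic:
  assumes "sup_norm n y < 1" "i < n"
  shows "wrap n y (Suc i) / (1 - wrap n y 0) = y i / (1 - sup_norm n y)"
proof -
  define s where "s = (\<Sum>i<n. (y i)\<^sup>2)"
  define r where "r = 1 - sup_norm n y"
  have D: "s + r\<^sup>2 \<noteq> 0" using wrap_denominator_pos[of y n] by (simp add: s_def r_def)
  have r: "r \<noteq> 0" using assms by (simp add: r_def)
  have "1 - (s - r\<^sup>2) / (s + r\<^sup>2) = 2 * r * r / (s + r\<^sup>2)"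
    using D by (simp add: field_simps power2_eq_square)
  then have "wrap n y (Suc i) / (1 - wrap n y 0) = (2 * r * y i / (s + r\<^sup>2)) / (2 * r * r / (s + r\<^sup>2))"
    using assms(2) by (simp add: wrap_0 wrap_Suc flip: s_def r_def)
  also have "\<dots> = y i / r" using D r by simp
  finally show ?thesis by (simp add: r_def)
qed

text \<open>Stereographic projection shows that the vectors \<open>y / (1 - sup_norm n y)\<close>
  and \<open>z / (1 - sup_norm n z)\<close> agree. Taking their norms and using that
  \<open>u / (1 - u)\<close> is injective for \<open>u < 1\<close> gives equal norms, hence equal
  vectors.\<close>

lemma wrap_inj:
  assumes y: "sup_norm n y < 1" and z: "sup_norm n z < 1" and eq: "wrap n y = wrap n z" and i: "i < n"
  shows "y i = z i"
proof -
  have yz: "y k / (1 - sup_norm n y) = z k / (1 - sup_norm n z)" if "k < n" for k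
    using wrap_stereographic[OF y that] wrap_stereographic[OF z that] eq by simp
  have "sup_norm n (\<lambda>k. 1 / (1 - sup_norm n y) * y k) = sup_norm n (\<lambda>k. 1 / (1 - sup_norm n z) * z k)"
    by (rule sup_norm_cong) (use yz in simp)
  then have "sup_norm n y / (1 - sup_norm n y) = sup_norm n z / (1 - sup_norm n z)"
    using y z sup_norm_scale[of "1 / (1 - sup_norm n y)" n y] sup_norm_scale[of "1 / (1 - sup_norm n z)" n z]
    by simp
  then have "sup_norm n y = sup_norm n z" using y z by (simp add: field_simps)
  then show ?thesis using yz[OF i] y by simp
qed

lemma wrap_surj:
  assumes p: "p \<in> topspace (nsphere n)" "p \<noteq> sphere_base"
  obtains y where "sup_norm n y < 1" "wrap n y = p"
proof -
  have sum1: "(\<Sum>k\<le>n. (p k)\<^sup>2) = 1" and out: "\<And>k. n < k \<Longrightarrow> p k = 0"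
    using p(1) by (auto simp: nsphere)
  have split: "(p 0)\<^sup>2 + (\<Sum>i<n. (p (Suc i))\<^sup>2) = 1"
    using sum1 by (simp only: sum.atMost_shift)
  have "p 0 \<noteq> 1"
  proof
    assume 0: "p 0 = 1"
    then have "(\<Sum>i<n. (p (Suc i))\<^sup>2) = 0" using split by simp
    then have "p (Suc i) = 0" if "i < n" for i using that by (simp add: sum_nonneg_eq_0_iff)
    then have "p k = sphere_base k" for k
    proof (cases k)
      case (Suc i)
      then show ?thesis
        using out[of k] \<open>\<And>i. i < n \<Longrightarrow> p (Suc i) = 0\<close>[of i] by (cases "i < n") (simp_all add: sphere_base_def)
    qed (simp add: 0 sphere_base_def)
    then show False using p(2) by blast
  qed
  define c where "c = p 0"
  have c: "c \<noteq> 1" using \<open>p 0 \<noteq> 1\<close> by (simp add: c_def)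
  have "c\<^sup>2 \<le> 1" using split sum_nonneg[of "{..<n}" "\<lambda>i. (p (Suc i))\<^sup>2"] by (simp add: c_def)
  then have c1: "c < 1" using c by (simp add: abs_square_le_1 abs_le_iff less_le)
  \<comment> \<open>The stereographic projection of \<open>p\<close> from the base point.\<close>
  define z where "z i = p (Suc i) / (1 - c)" for i
  \<comment> \<open>Scaling by \<open>t\<close> inverts the stretching by
    \<open>1 / (1 - sup_norm n y)\<close>: for \<open>y = t * z\<close> the remaining distance
    \<open>1 - sup_norm n y\<close> is \<open>t\<close> itself.\<close>
  define t where "t = 1 / (1 + sup_norm n z)"
  have t: "0 < t" using sup_norm_nonneg[of n z] by (simp add: t_def add_pos_nonneg)
  define y where "y i = t * z i" for i
  have \<rho>: "sup_norm n y = t * sup_norm n z" unfolding y_def using t by (simp add: sup_norm_scale)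
  have r: "1 - sup_norm n y = t"
    using sup_norm_nonneg[of n z] unfolding \<rho> t_def by (simp add: field_simps)
  have "(\<Sum>i<n. (z i)\<^sup>2) = (\<Sum>i<n. (p (Suc i))\<^sup>2) / (1 - c)\<^sup>2"
    by (simp add: z_def power_divide sum_divide_distrib)
  also have "(\<Sum>i<n. (p (Suc i))\<^sup>2) = (1 - c) * (1 + c)"
    using split by (simp add: c_def power2_eq_square algebra_simps)
  finally have zz: "(\<Sum>i<n. (z i)\<^sup>2) = (1 + c) / (1 - c)"
    using c1 by (simp add: power2_eq_square)
  have s: "(\<Sum>i<n. (y i)\<^sup>2) = t\<^sup>2 * ((1 + c) / (1 - c))"
    by (simp add: y_def power_mult_distrib zz flip: sum_distrib_left)
  have D: "t\<^sup>2 * ((1 + c) / (1 - c)) + t\<^sup>2 = t\<^sup>2 * (2 / (1 - c))"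
    using c1 by (simp add: field_simps)
  have N: "t\<^sup>2 * ((1 + c) / (1 - c)) - t\<^sup>2 = t\<^sup>2 * (2 * c / (1 - c))"
    using c1 by (simp add: field_simps)
  have "wrap n y = p"
  proof
    fix k
    show "wrap n y k = p k"
    proof (cases k)
      case 0
      have "wrap n y 0 = t\<^sup>2 * (2 * c / (1 - c)) / (t\<^sup>2 * (2 / (1 - c)))"
        by (simp only: wrap_0 r s D N)
      then show ?thesis using 0 t c1 by (simp add: c_def)
    next
      case (Suc i)
      have "wrap n y k = 2 * t * y i / (t\<^sup>2 * (2 / (1 - c)))" if "i < n"
        using that by (simp only: Suc wrap_Suc r s D if_True)
      then show ?thesis
        using Suc t c1 out[of k] by (cases "i < n") (simp_all add: wrap_Suc y_def z_def power2_eq_square)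
    qed
  qed
  moreover have "sup_norm n y < 1" using r t by simp
  ultimately show ?thesis using that by blast
qed

lemma continuous_on_wrap:
  assumes "\<And>i. continuous_on S (\<lambda>x. g x i)"
  shows "continuous_on S (\<lambda>x. wrap n (g x))"
proof (rule continuous_on_coordinatewise_then_product)
  fix k
  have D: "(\<Sum>i<n. (g x i)\<^sup>2) + (1 - sup_norm n (g x))\<^sup>2 \<noteq> 0" for x
    using wrap_denominator_pos[of "g x" n] by simp
  note sn = continuous_on_sup_norm[of S g n, OF assms]
  show "continuous_on S (\<lambda>x. wrap n (g x) k)"
  proof (cases k)
    case 0
    then show ?thesis using D
      by (simp only: wrap_0)
        (intro continuous_on_divide continuous_on_diff continuous_on_add continuous_on_sum continuous_on_power
          continuous_on_const assms sn ballI)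
  next
    case (Suc i)
    then show ?thesis using D
      by (simp only: wrap_Suc)
        (intro continuous_on_If_const continuous_on_divide continuous_on_mult continuous_on_diff continuous_on_add
          continuous_on_sum continuous_on_power continuous_on_const assms sn ballI)
  qed
qed

text \<open>Each block has the single position 0; the affine change carries \<open>[0,1]\<close> to
  \<open>[-1,1]\<close>, so that \<open>sup_norm\<close> equals 1 on the boundary.\<close>

definition cube_to_sphere :: "nat \<Rightarrow> (nat \<Rightarrow> real) \<Rightarrow> nat \<Rightarrow> real" where
  "cube_to_sphere n x = wrap n (\<lambda>i. 2 * coord x i 0 - 1)"

text \<open>In a block of length one the vertices are the two endpoints, the points where the
  rescaled coordinate has absolute value 1. So the based points are exactly the boundary of the
  cube.\<close>

lemma unit_cube_sup_norm:
  assumes "x \<in> cube n (replicate n 1)"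
  shows "sup_norm n (\<lambda>i. 2 * coord x i 0 - 1) \<le> 1"
    and "sup_norm n (\<lambda>i. 2 * coord x i 0 - 1) = 1 \<longleftrightarrow> x \<in> cube_base n (replicate n 1)"
proof -
  have b: "\<bar>2 * coord x i 0 - 1\<bar> \<le> 1" for i
    using coord_cube_bounds[OF assms, of i 0] by (simp add: abs_le_iff)
  show le: "sup_norm n (\<lambda>i. 2 * coord x i 0 - 1) \<le> 1"
    using sup_norm_cases[of n "\<lambda>i. 2 * coord x i 0 - 1"] b by auto
  have "sup_norm n (\<lambda>i. 2 * coord x i 0 - 1) = 1 \<longleftrightarrow> (\<exists>i<n. \<bar>2 * coord x i 0 - 1\<bar> = 1)"
  proof
    assume "sup_norm n (\<lambda>i. 2 * coord x i 0 - 1) = 1"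
    then show "\<exists>i<n. \<bar>2 * coord x i 0 - 1\<bar> = 1"
      using sup_norm_cases[of n "\<lambda>i. 2 * coord x i 0 - 1"] by auto
  next
    assume "\<exists>i<n. \<bar>2 * coord x i 0 - 1\<bar> = 1"
    then obtain i where "i < n" "\<bar>2 * coord x i 0 - 1\<bar> = 1" by blast
    then show "sup_norm n (\<lambda>i. 2 * coord x i 0 - 1) = 1"
      using abs_le_sup_norm[of i n "\<lambda>i. 2 * coord x i 0 - 1"] le by simp
  qed
  also have "\<dots> \<longleftrightarrow> x \<in> cube_base n (replicate n 1)"
  proof -
    have "\<bar>2 * coord x i 0 - 1\<bar> = 1 \<longleftrightarrow> is_vertex (replicate n 1 ! i) (coord x i)" if "i < n" for i
      using that by (auto simp: is_vertex_def monotone_on_def abs_if Pi_iff)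
    then show ?thesis using assms by (auto simp: cube_base_def)
  qed
  finally show "sup_norm n (\<lambda>i. 2 * coord x i 0 - 1) = 1 \<longleftrightarrow> x \<in> cube_base n (replicate n 1)" .
qed

lemma cube_to_sphere_surj:
  assumes "p \<in> topspace (nsphere n)" "p \<noteq> sphere_base"
  shows "p \<in> cube_to_sphere n ` cube n (replicate n 1)"
proof -
  obtain y where y: "sup_norm n y < 1" "wrap n y = p" using wrap_surj[OF assms] .
  let ?x = "point_of n (replicate n 1) (\<lambda>i j. (y i + 1) / 2)"
  have "?x \<in> cube n (replicate n 1)"
  proof (rule point_of_in_cube)
    fix i j assume "i < n"
    then have "\<bar>y i\<bar> < 1" using abs_le_sup_norm[of i n y] y by simp
    then show "0 \<le> (y i + 1) / 2 \<and> (y i + 1) / 2 \<le> 1" by (simp add: abs_less_iff)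
  qed
  moreover have "cube_to_sphere n ?x = wrap n y"
    unfolding cube_to_sphere_def by (rule wrap_cong) (simp add: field_simps)
  ultimately show ?thesis using y by force
qed

text \<open>Off the boundary the rescaled norm is below 1, where \<open>wrap\<close> determines the
  first \<open>n\<close> coordinates; the remaining entries of a point of the cube are zero.\<close>

lemma inj_on_cube_to_sphere:
  "inj_on (cube_to_sphere n) (cube n (replicate n 1) - cube_base n (replicate n 1))"
proof (rule inj_onI)
  fix x x'
  assume x: "x \<in> cube n (replicate n 1) - cube_base n (replicate n 1)"
    and x': "x' \<in> cube n (replicate n 1) - cube_base n (replicate n 1)"
    and eq: "cube_to_sphere n x = cube_to_sphere n x'"
  have xc: "x \<in> cube n (replicate n 1)" "x' \<in> cube n (replicate n 1)" using x x' by auto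
  have lt: "sup_norm n (\<lambda>i. 2 * coord x i 0 - 1) < 1" "sup_norm n (\<lambda>i. 2 * coord x' i 0 - 1) < 1"
    using unit_cube_sup_norm[OF xc(1)] unit_cube_sup_norm[OF xc(2)] x x' by auto
  have c: "coord x i 0 = coord x' i 0" if "i < n" for i
    using wrap_inj[OF lt eq[unfolded cube_to_sphere_def] that] by simp
  show "x = x'"
  proof (rule coord_eqI)
    fix i j
    show "coord x i j = coord x' i j"
      using c[of i] coord_cube_out[OF xc(1), of i j] coord_cube_out[OF xc(2), of i j]
      by (cases "i < n \<and> j = 0") auto
  qed
qed

lemma Hausdorff_nsphere: "Hausdorff_space (nsphere n)"
  unfolding nsphere by (intro Hausdorff_space_subtopology) (simp add: Hausdorff_space_product_topology)

lemma continuous_map_cube_to_sphere: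
  "continuous_map (top_of_set K) (nsphere n) (cube_to_sphere n)"
proof -
  have "continuous_on K (cube_to_sphere n)"
    unfolding cube_to_sphere_def[abs_def]
    by (intro continuous_on_wrap continuous_on_diff continuous_on_mult continuous_on_const continuous_on_coord continuous_on_id)
  then have "continuous_map (top_of_set K) (powertop_real UNIV) (cube_to_sphere n)"
    by (simp add: euclidean_product_topology)
  then show ?thesis
    using wrap_in_nsphere by (auto simp: nsphere continuous_map_in_subtopology cube_to_sphere_def)
qed

context based_space
begin

theorem unit_cube_homeomorphic_loop_space:
  "map_space (cube n (replicate n 1)) (cube_base n (replicate n 1)) homeomorphic_space loop_space n B b0"
  unfolding loop_space_def based_maps_set_def kify_eq_kification
proof (rule map_space_homeomorphic_quotient)
  show "sphere_base \<in> topspace (nsphere n)"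
    unfolding sphere_base_def by (rule in_topspace_nsphere)
  show "cube_to_sphere n x = sphere_base \<longleftrightarrow> x \<in> cube_base n (replicate n 1)" if "x \<in> cube n (replicate n 1)" for x
    unfolding cube_to_sphere_def wrap_eq_base_iff by (rule unit_cube_sup_norm(2)[OF that])
  show "topspace (nsphere n) - {sphere_base} \<subseteq> cube_to_sphere n ` cube n (replicate n 1)"
    using cube_to_sphere_surj by blast
qed (rule compact_cube Hausdorff_nsphere cube_base_subset continuous_map_cube_to_sphere inj_on_cube_to_sphere)+

end

theorem theorem4p2p1:
  fixes B :: "'b topology" and b0 :: 'b and n :: nat
  assumes "cgh_space B" and "b0 \<in> topspace B"
  shows "\<exists>(X :: nat list \<Rightarrow> ((nat \<Rightarrow> real) \<times> ((nat \<Rightarrow> real) \<Rightarrow> 'b)) topology) Xf xi.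
           homotopy_mon_algebra n X Xf xi \<and>
           X (replicate n 1) homeomorphic_space loop_space n B b0"
proof -
  interpret based_space B b0
    by unfold_locales (use assms in \<open>simp_all add: cgh_space_def\<close>)
  have "cube_space n (replicate n 1) homeomorphic_space loop_space n B b0"
    unfolding cube_space_def by (rule unit_cube_homeomorphic_loop_space)
  with homotopy_mon_algebra_cube_space show ?thesis by blast
qed

end
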